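(* Let $F:\mathbb{R}^n\rightrightarrows\mathbb{R}^n$ be a multifunction satisfying (F1)-(F3) of the context, with bilateral minimal time function $T$ and Hamiltonian $h$. Let $(\alpha,\beta)\in\mathbb{R}^n\times\mathbb{R}^n$ be such that $0<r:=T(\alpha,\beta)<\infty$. Then $$\widehat{\partial}T(\alpha,\beta)=\widehat{N}_{\mathcal{R}(r)}(\alpha,\beta)\cap\{(\zeta,\theta)\in\mathbb{R}^n\times\mathbb{R}^n: h(\alpha,\zeta)=h(\beta,-\theta)=-1\}.$$
   Context: $\|\cdot\|$ and $\langle\cdot,\cdot\rangle$ denote the Euclidean norm and inner product (also on product spaces), and $\bar B$ the closed unit ball of $\mathbb{R}^n$. Assumptions on $F:\mathbb{R}^n\rightrightarrows\mathbb{R}^n$: (F1) $F(x)$ is nonempty, compact and convex for every $x\in\mathbb{R}^n$. (F2) $F$ is locally Lipschitz: for every compact set $K\subset\mathbb{R}^n$ there is a constant $L=L(K)$ such that $F(x)\subset F(y)+L\|y-x\|\bar B$ for all $x,y\in K$. (F3) There are positive constants $\gamma,c$ such that for all $x\in\mathbb{R}^n$, $v\in F(x)$ implies $\|v\|\le\gamma\|x\|+c$. A trajectory of $F$ is an absolutely continuous function $x(\cdot)$ with $\dot x(t)\in F(x(t))$ for a.e. $t$ in its interval of definition. The bilateral minimal time function $T:\mathbb{R}^n\times\mathbb{R}^n\to[0,+\infty]$ is $T(\alpha,\beta)=\inf\{\tau\ge 0:\text{ there is a trajectory }x(\cdot)\text{ of }F\text{ on }[0,\tau]\text{ with }x(0)=\alpha,\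 x(\tau)=\beta\}$, with $T(\alpha,\beta)=+\infty$ if there is no such trajectory. The Hamiltonian is $h(x,p)=\min_{v\in F(x)}\langle v,p\rangle$ for $(x,p)\in\mathbb{R}^n\times\mathbb{R}^n$. For $t>0$, $\mathcal{R}(t)=\{(x,y)\in\mathbb{R}^n\times\mathbb{R}^n: T(x,y)\le t\}$. For a closed set $S\subset\mathbb{R}^m$ and $x\in S$, the Fréchet normal cone $\widehat{N}_S(x)$ is the set of $\zeta\in\mathbb{R}^m$ with $\limsup_{S\ni y\to x}\frac{\langle\zeta,y-x\rangle}{\|y-x\|}\le 0$, i.e. for every $\varepsilon>0$ there is $\delta>0$ with $\langle\zeta,y-x\rangle\le\varepsilon\|y-x\|$ for all $y\in S$ with $\|y-x\|<\delta$. For $f:\mathbb{R}^m\to\mathbb{R}\cup\{+\infty\}$ and $x$ with $f(x)<+\infty$, the Fréchet subdifferential is $\widehat{\partial}f(x)=\left\{\zeta\in\mathbb{R}^m:\liminf_{y\to x}\frac{f(y)-f(x)-\langle\zeta,y-x\rangle}{\|y-x\|}\ge 0\right\}$. *)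

theory Defs
  imports "HOL-Analysis.Analysis"
begin

type_synonym 'n multifunction = "real ^ 'n \<Rightarrow> (real ^ 'n) set"

definition compact_convex_valued :: "'n::finite multifunction \<Rightarrow> bool" where
  "compact_convex_valued F \<longleftrightarrow> (\<forall>x. F x \<noteq> {} \<and> compact (F x) \<and> convex (F x))"

definition locally_Lipschitz :: "'n::finite multifunction \<Rightarrow> bool" where
  "locally_Lipschitz F \<longleftrightarrow>
     (\<forall>K. compact K \<longrightarrow> (\<exists>L. \<forall>x\<in>K. \<forall>y\<in>K.
        F x \<subseteq> {v + (L * norm (y - x)) *\<^sub>R b | v b. v \<in> F y \<and> b \<in> cball 0 1}))"

definition linear_growth :: "'n::finite multifunction \<Rightarrow> bool" where
  "linear_growth F \<longleftrightarrow>
     (\<exists>\<gamma>>0. \<exists>c>0. \<forall>x. \<forall>v\<in>F x. norm v \<le> \<gamma> * norm x + c)"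

text \<open>
  The usual epsilon-delta absolute continuity of a curve. A division is a finite family of
  compact intervals with pairwise disjoint interiors, whose endpoints are \<^term>\<open>Inf k\<close> and
  \<^term>\<open>Sup k\<close>. (The library constant \<^const>\<open>absolutely_continuous\<close> is about measures.)
\<close>

definition abs_continuous_on :: "real set \<Rightarrow> (real \<Rightarrow> 'a::real_normed_vector) \<Rightarrow> bool" where
  "abs_continuous_on S x \<longleftrightarrow>
     (\<forall>\<epsilon>>0. \<exists>\<delta>>0. \<forall>d t. d division_of t \<and> t \<subseteq> S \<and> (\<Sum>k\<in>d. measure lborel k) < \<delta> \<longrightarrow>
        (\<Sum>k\<in>d. norm (x (Sup k) - x (Inf k))) < \<epsilon>)"

definition trajectory_on :: "'n::finite multifunction \<Rightarrow> real set \<Rightarrow> (real \<Rightarrow> real ^ 'n) \<Rightarrow> bool" where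
  "trajectory_on F S x \<longleftrightarrow> abs_continuous_on S x \<and>
     (AE t in lebesgue. t \<in> S \<longrightarrow>
        (\<exists>v \<in> F (x t). (x has_vector_derivative v) (at t within S)))"

text \<open>The infimum is taken in \<^typ>\<open>ereal\<close>, so it is \<^term>\<open>\<infinity> :: ereal\<close> when no trajectory exists.\<close>

definition min_time :: "'n::finite multifunction \<Rightarrow> real ^ 'n \<Rightarrow> real ^ 'n \<Rightarrow> ereal" where
  "min_time F \<alpha> \<beta> = Inf {ereal \<tau> | \<tau>. 0 \<le> \<tau> \<and>
     (\<exists>x. trajectory_on F {0..\<tau>} x \<and> x 0 = \<alpha> \<and> x \<tau> = \<beta>)}"

definition hamiltonian :: "'n::finite multifunction \<Rightarrow> real ^ 'n \<Rightarrow> real ^ 'n \<Rightarrow> real" where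
  "hamiltonian F x p = (LEAST m. \<exists>v\<in>F x. m = v \<bullet> p)"

definition reachable_pairs :: "'n::finite multifunction \<Rightarrow> real \<Rightarrow> ((real ^ 'n) \<times> (real ^ 'n)) set" where
  "reachable_pairs F t = {(x, y). min_time F x y \<le> ereal t}"

definition frechet_normal_cone :: "'a::euclidean_space set \<Rightarrow> 'a \<Rightarrow> 'a set" where
  "frechet_normal_cone S x =
     {\<zeta>. \<forall>\<epsilon>>0. \<exists>\<delta>>0. \<forall>y\<in>S. norm (y - x) < \<delta> \<longrightarrow> \<zeta> \<bullet> (y - x) \<le> \<epsilon> * norm (y - x)}"

text \<open>Only meaningful at points where \<^term>\<open>f x\<close> is finite.\<close>

definition frechet_subdifferential :: "('a::euclidean_space \<Rightarrow> ereal) \<Rightarrow> 'a \<Rightarrow> 'a set" where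
  "frechet_subdifferential f x =
     {\<zeta>. 0 \<le> Liminf (at x) (\<lambda>y. (f y - f x - ereal (\<zeta> \<bullet> (y - x))) / ereal (norm (y - x)))}"

end

theory Submission
  imports Defs
begin

text \<open>
  Absolutely continuous curves obey the mean value inequality. Hence every trajectory issued from a
  point near \<open>\<alpha>\<close> decreases a linear form \<open>\<zeta>\<close> at a rate of at most \<open>- h(\<alpha>, \<zeta>)\<close>, up to second order
  terms. Conversely, Filippov's successive projections give, for each \<open>v \<in> F \<alpha>\<close>, a trajectory that
  leaves (or, after time reversal, enters) a nearby point with velocity close to \<open>v\<close>.

  For a subgradient, following a nearly optimal trajectory gives \<open>h(\<alpha>, \<zeta>) \<le> -1\<close>, and arriving
  at \<open>\<alpha>\<close> with velocity \<open>v\<close> gives \<open>\<langle>v, \<zeta>\<rangle> \<ge> -1\<close>. The endpoint \<open>\<beta>\<close> is treated by replacing \<open>F\<close>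
  with \<open>-F\<close>, which reverses time.

  For a normal to \<open>\<R>(r)\<close>, let \<open>\<rho>\<close> be the distance of \<open>(x, y)\<close> to \<open>(\<alpha>, \<beta>)\<close> and let \<open>\<tau>\<close> be the time
  of a trajectory from \<open>x\<close> to \<open>y\<close>. If \<open>\<tau> \<ge> r\<close>, move \<open>x\<close> forward along the trajectory by
  \<open>\<tau> - r\<close>. If \<open>\<tau> < r\<close>, move it backward by \<open>min (r - \<tau>) (K \<rho>)\<close>. The cut-off at \<open>K \<rho>\<close> makes lower
  semicontinuity of the minimal time, and so the existence of optimal trajectories, unnecessary.
\<close>

section \<open>Absolutely continuous curves\<close>

text \<open>Distinct intervals of a division meet only in negligible sets, so their contents add up
  to the measure of their union.\<close>

lemma sum_measure_division_le:
  fixes U :: "real set"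
  assumes "d division_of t" "t \<subseteq> U" "U \<in> lmeasurable"
  shows "(\<Sum>k\<in>d. measure lborel k) \<le> measure lebesgue U"
proof -
  have "measure lebesgue (\<Union>d) = (\<Sum>k\<in>d. measure lebesgue k)"
  proof (rule measure_negligible_finite_Union)
    show "finite d" using assms(1) by blast
    show "S \<in> lmeasurable" if "S \<in> d" for S
      using division_ofD(4)[OF assms(1) that] by auto
    show "pairwise (\<lambda>S T. negligible (S \<inter> T)) d"
    proof (rule pairwiseI)
      fix S T assume ST: "S \<in> d" "T \<in> d" "S \<noteq> T"
      obtain a b c e where "S = cbox a b" "T = cbox c e"
        using division_ofD(4)[OF assms(1)] ST by metis
      then show "negligible (S \<inter> T)"
        using division_ofD(5)[OF assms(1) ST]
        by (simp add: negligible_convex_interior convex_Int convex_box)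
    qed
  qed
  also have "(\<Sum>k\<in>d. measure lebesgue k) = (\<Sum>k\<in>d. measure lborel k)"
    using division_ofD(4)[OF assms(1)] by (intro sum.cong refl) (metis cbox_borel measure_completion sets_lborel)
  finally have "(\<Sum>k\<in>d. measure lborel k) = measure lebesgue t"
    using division_ofD(6)[OF assms(1)] by simp
  also have "t \<in> lmeasurable"
    using division_ofD(1,4,6)[OF assms(1)]
    by (metis compact_Union compact_cbox lmeasurable_compact)
  then have "measure lebesgue t \<le> measure lebesgue U"
    using assms by (intro measure_mono_fmeasurable) auto
  finally show ?thesis .
qed

text \<open>Cousin's lemma with a gauge that confines the intervals tagged in the exceptional null set
  to an open set of small measure, where absolute continuity controls the increments.\<close>

lemma abs_continuous_increment_le:
  fixes g :: "real \<Rightarrow> real"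
  assumes ac: "abs_continuous_on {a..b} g" and ab: "a \<le> b" and N: "negligible N"
    and der: "\<And>t. t \<in> {a..b} - N \<Longrightarrow> \<exists>D\<le>m. (g has_vector_derivative D) (at t within {a..b})"
  shows "g b - g a \<le> m * (b - a)"
proof -
  \<comment> \<open>Off the exceptional set the slope is at most \<open>m + e\<close>. The last term
    pays for the intervals tagged in \<open>N\<close>: \<open>e\<close> for their increments and
    \<open>\<bar>m\<bar> * e\<close> for their length, which is lost when \<open>m\<close> is
    negative.\<close>
  have key: "g b - g a \<le> (m + e) * (b - a) + (\<bar>m\<bar> + 1) * e" if e: "e > 0" for e
  proof -
    obtain \<delta> where \<delta>: "\<delta> > 0" "\<And>d t. d division_of t \<Longrightarrow> t \<subseteq> {a..b} \<Longrightarrow>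
        (\<Sum>k\<in>d. measure lborel k) < \<delta> \<Longrightarrow> (\<Sum>k\<in>d. norm (g (Sup k) - g (Inf k))) < e"
      using ac e unfolding abs_continuous_on_def by metis
    have Ns: "N \<in> sets lebesgue" using N by (simp add: negligible_imp_sets)
    have \<delta>e: "min \<delta> e > 0" using \<delta>(1) e by simp
    \<comment> \<open>The bound \<open>\<delta>\<close> makes absolute continuity applicable to the
      intervals inside \<open>U\<close>; the bound \<open>e\<close> limits their total
      length.\<close>
    obtain U where U: "open U" "N \<subseteq> U" "U - N \<in> lmeasurable" "emeasure lebesgue (U - N) < ennreal (min \<delta> e)"
      using sets_lebesgue_outer_open[OF Ns \<delta>e] by blast
    have Um: "U \<in> lmeasurable"
      using U N by (metis Diff_partition fmeasurable.Un negligible_imp_measurable)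
    have "measure lebesgue U = measure lebesgue (U - N)"
      using N Um U(3)
      by (intro measure_negligible_symdiff[symmetric]) (auto intro: negligible_subset)
    also have "\<dots> < min \<delta> e" using U(4) \<delta>(1) U(3)
      by (metis emeasure_eq_measure2 ennreal_less_iff measure_nonneg)
    finally have U\<delta>: "measure lebesgue U < min \<delta> e" .
    \<comment> \<open>Straddle estimate: since the tag lies between \<open>u\<close> and
      \<open>v\<close>, the two one-sided errors add up to exactly
      \<open>e * (v - u)\<close>.\<close>
    have "\<exists>\<eta>>0. \<forall>u v. a \<le> u \<and> u \<le> t \<and> t \<le> v \<and> v \<le> b \<and> t - u < \<eta> \<and> v - t < \<eta> \<longrightarrow>
        g v - g u \<le> (m + e) * (v - u)" if t: "t \<in> {a..b} - N" for t
    proof -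
      obtain D where D: "D \<le> m" "(g has_vector_derivative D) (at t within {a..b})" using der[OF t] by blast
      obtain \<eta> where \<eta>: "\<eta> > 0" "\<And>y. y \<in> {a..b} \<Longrightarrow> norm (y - t) < \<eta> \<Longrightarrow>
          norm (g y - g t - (y - t) * D) \<le> e * norm (y - t)"
        using D(2) e unfolding has_vector_derivative_def has_derivative_within_alt by (auto simp: mult.commute)
      show ?thesis
      proof (intro exI conjI allI impI)
        show "\<eta> > 0" by fact
        fix u v assume uv: "a \<le> u \<and> u \<le> t \<and> t \<le> v \<and> v \<le> b \<and> t - u < \<eta> \<and> v - t < \<eta>"
        have "g v - g t \<le> D * (v - t) + e * (v - t)" using \<eta>(2)[of v] uv t by (auto simp: mult.commute)
        moreover have "g t - g u \<le> D * (t - u) + e * (t - u)"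
          using \<eta>(2)[of u] uv t by (auto simp: algebra_simps)
        ultimately have "g v - g u \<le> (D + e) * (v - u)" by (simp add: algebra_simps)
        also have "\<dots> \<le> (m + e) * (v - u)" using D uv by (intro mult_right_mono) auto
        finally show "g v - g u \<le> (m + e) * (v - u)" .
      qed
    qed
    then obtain \<eta> where \<eta>: "\<And>t. t \<in> {a..b} - N \<Longrightarrow> \<eta> t > 0"
      "\<And>t u v. t \<in> {a..b} - N \<Longrightarrow> a \<le> u \<Longrightarrow> u \<le> t \<Longrightarrow> t \<le> v \<Longrightarrow> v \<le> b \<Longrightarrow> t - u < \<eta> t \<Longrightarrow> v - t < \<eta> t \<Longrightarrow>
        g v - g u \<le> (m + e) * (v - u)" by metis
    define \<gamma> where "\<gamma> t = (if t \<in> N then U else if t \<in> {a..b} then ball t (\<eta> t) else ball t 1)" for t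
    have "gauge \<gamma>" unfolding gauge_def \<gamma>_def using U \<eta>(1) by auto
    then obtain p where p: "p tagged_division_of {a..b}" "\<gamma> fine p"
      using fine_division_exists_real by blast
    note pD = tagged_division_ofD[OF p(1)]
    define p1 where "p1 = {(t,k) \<in> p. t \<in> N}"
    \<comment> \<open>Only degenerate intervals can carry several tags, so passing from tagged
      intervals to the set of intervals requires them to contribute 0. The empty interval gets this
      value explicitly because its \<open>Sup\<close> and \<open>Inf\<close> mean nothing.\<close>
    define d where "d = (\<lambda>k. if k = {} then 0 else norm (g (Sup k) - g (Inf k)))"
    define q where "q = (\<lambda>(t::real,k). g (Sup k) - g (Inf k))"
    have fin: "finite p" by fact
    have p1: "p1 \<subseteq> p" by (auto simp: p1_def)
    have part: "p1 tagged_partial_division_of {a..b}"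
      using p(1) p1 tagged_division_of tagged_partial_division_subset
      by (metis tagged_division_of_def)
    have div: "snd ` p1 division_of \<Union>(snd ` p1)" by (rule partial_division_of_tagged_division[OF part])
    have "\<Union>(snd ` p1) \<subseteq> U"
      using p(2) unfolding fine_def p1_def \<gamma>_def by fastforce
    then have small: "(\<Sum>k\<in>snd ` p1. measure lborel k) < min \<delta> e"
      using sum_measure_division_le[OF div _ Um] U\<delta> by linarith
    have sub: "\<Union>(snd ` p1) \<subseteq> {a..b}" using pD(3) p1 by fastforce
    have "(\<Sum>x\<in>p1. q x) \<le> (\<Sum>x\<in>p1. (\<lambda>(_,k). d k) x)"
      using pD(2) p1 by (intro sum_mono) (fastforce simp: q_def d_def)
    also have "\<dots> = (\<Sum>k\<in>snd ` p1. d k)"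
    proof (rule sum.over_tagged_division_lemma[OF tagged_partial_division_of_Union_self[OF part]])
      fix u v :: real assume "box u v = {}"
      then have "v \<le> u" by simp
      then show "d (cbox u v) = 0" by (cases "u = v") (auto simp: d_def)
    qed
    also have "\<dots> \<le> (\<Sum>k\<in>snd ` p1. norm (g (Sup k) - g (Inf k)))"
      by (intro sum_mono) (auto simp: d_def)
    also have "\<dots> < e" by (rule \<delta>(2)[OF div sub]) (use small in simp)
    finally have s1: "(\<Sum>x\<in>p1. q x) < e" .
    have "(\<Sum>x\<in>p1. (\<lambda>(t,k). measure lborel k) x) = (\<Sum>k\<in>snd ` p1. measure lborel k)"
      by (rule sum.over_tagged_division_lemma[OF tagged_partial_division_of_Union_self[OF part]])
        (simp add: content_eq_0_interior)
    then have s2: "(\<Sum>x\<in>p1. (\<lambda>(t,k). measure lborel k) x) < e" using small by simp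
    have s3: "0 \<le> (\<Sum>x\<in>p1. (\<lambda>(t,k). measure lborel k) x)" by (intro sum_nonneg) auto
    have qle: "q x \<le> (m + e) * (\<lambda>(t,k). measure lborel k) x" if x: "x \<in> p - p1" for x
    proof -
      obtain t k where tk: "x = (t,k)" by (cases x)
      have mem: "(t,k) \<in> p" "t \<notin> N" using x tk by (auto simp: p1_def)
      obtain u v where k: "k = cbox u v" using pD(4)[OF mem(1)] by blast
      have tuv: "u \<le> t" "t \<le> v" using pD(2)[OF mem(1)] k by auto
      have kab: "k \<subseteq> {a..b}" using pD(3)[OF mem(1)] .
      then have uv: "a \<le> u" "v \<le> b" using k tuv by auto
      have t: "t \<in> {a..b} - N" using mem uv tuv by auto
      have "k \<subseteq> \<gamma> t" using p(2) mem unfolding fine_def by auto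
      then have "k \<subseteq> ball t (\<eta> t)" using t by (auto simp: \<gamma>_def)
      moreover have "u \<in> k" "v \<in> k" using k tuv by auto
      ultimately have "t - u < \<eta> t" "v - t < \<eta> t" using tuv by (auto simp: dist_real_def)
      then show ?thesis using \<eta>(2)[OF t uv(1) tuv uv(2)] tk k tuv by (simp add: q_def)
    qed
    have ctot: "(\<Sum>(t,k)\<in>p. measure lborel k) = b - a"
      using additive_content_tagged_division[of p a b] p(1) ab by simp
    have "g b - g a = (\<Sum>x\<in>p. q x)"
      using additive_tagged_division_1[OF ab p(1), of g] by (simp add: q_def)
    also have "\<dots> = (\<Sum>x\<in>p - p1. q x) + (\<Sum>x\<in>p1. q x)"
      by (rule sum.subset_diff[OF p1 fin])
    also have "\<dots> \<le> (\<Sum>x\<in>p - p1. (m + e) * (\<lambda>(t,k). measure lborel k) x) + e"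
      using s1 sum_mono[of "p - p1" q, OF qle] by linarith
    also have "(\<Sum>x\<in>p - p1. (m + e) * (\<lambda>(t,k). measure lborel k) x) = (m + e) * (\<Sum>x\<in>p - p1. (\<lambda>(t,k). measure lborel k) x)"
      by (simp add: sum_distrib_left)
    also have "(\<Sum>x\<in>p - p1. (\<lambda>(t,k). measure lborel k) x) = (b - a) - (\<Sum>x\<in>p1. (\<lambda>(t,k). measure lborel k) x)"
      using sum.subset_diff[OF p1 fin, of "\<lambda>(t,k). measure lborel k"] ctot by simp
    finally have "g b - g a \<le> (m + e) * (b - a) - (m + e) * (\<Sum>x\<in>p1. (\<lambda>(t,k). measure lborel k) x) + e"
      by (simp add: algebra_simps)
    moreover have "- (m + e) * (\<Sum>x\<in>p1. (\<lambda>(t,k). measure lborel k) x) \<le> \<bar>m\<bar> * (\<Sum>x\<in>p1. (\<lambda>(t,k). measure lborel k) x)"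
      using s3 e by (intro mult_right_mono) auto
    moreover have "\<dots> \<le> \<bar>m\<bar> * e" using s2 by (intro mult_left_mono) auto
    ultimately show ?thesis by (simp add: algebra_simps)
  qed
  have "((\<lambda>e. (m + e) * (b - a) + (\<bar>m\<bar> + 1) * e) \<longlongrightarrow> (m + 0) * (b - a) + (\<bar>m\<bar> + 1) * 0) (at_right 0)"
    by (intro tendsto_intros)
  then have "g b - g a \<le> (m + 0) * (b - a) + (\<bar>m\<bar> + 1) * 0"
    by (rule tendsto_lowerbound) (auto simp: eventually_at_filter key)
  then show ?thesis by simp
qed

lemma lipschitz_imp_abs_continuous_on:
  fixes x :: "real \<Rightarrow> 'a::real_normed_vector"
  assumes "L-lipschitz_on {a..b} x"
  shows "abs_continuous_on {a..b} x"
  unfolding abs_continuous_on_def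
proof (intro allI impI)
  fix \<epsilon> :: real assume \<epsilon>: "\<epsilon> > 0"
  have L: "L \<ge> 0" using assms by (rule lipschitz_on_nonneg)
  show "\<exists>\<delta>>0. \<forall>d t. d division_of t \<and> t \<subseteq> {a..b} \<and> (\<Sum>k\<in>d. measure lborel k) < \<delta> \<longrightarrow>
        (\<Sum>k\<in>d. norm (x (Sup k) - x (Inf k))) < \<epsilon>"
  \<comment> \<open>\<open>L + 1\<close> keeps the quotient positive when
    \<open>L = 0\<close>.\<close>
  proof (intro exI[of _ "\<epsilon> / (L + 1)"] conjI allI impI)
    show "\<epsilon> / (L + 1) > 0" using \<epsilon> L by simp
    fix d t assume dt: "d division_of t \<and> t \<subseteq> {a..b} \<and> (\<Sum>k\<in>d. measure lborel k) < \<epsilon> / (L + 1)"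
    then have d: "d division_of t" by simp
    have "norm (x (Sup k) - x (Inf k)) \<le> (L + 1) * measure lborel k" if k: "k \<in> d" for k
    proof -
      obtain u v where uv: "k = {u..v}" using division_ofD(4)[OF d k] by auto
      have ne: "u \<le> v" using division_ofD(3)[OF d k] uv by auto
      have "k \<subseteq> {a..b}" using division_ofD(2)[OF d k] dt by blast
      then have "norm (x v - x u) \<le> L * \<bar>v - u\<bar>"
        using lipschitz_onD[OF assms, of v u] ne uv by (auto simp: dist_norm)
      also have "\<dots> \<le> (L + 1) * (v - u)" using ne by (auto intro!: mult_right_mono)
      finally show ?thesis using uv ne by simp
    qed
    then have "(\<Sum>k\<in>d. norm (x (Sup k) - x (Inf k))) \<le> (L + 1) * (\<Sum>k\<in>d. measure lborel k)"
      by (simp add: sum_distrib_left sum_mono)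
    also have "\<dots> < \<epsilon>" using dt L by (simp add: field_simps)
    finally show "(\<Sum>k\<in>d. norm (x (Sup k) - x (Inf k))) < \<epsilon>" .
  qed
qed

lemma abs_continuous_on_imp_continuous_on:
  fixes x :: "real \<Rightarrow> 'a::real_normed_vector"
  assumes "abs_continuous_on {a..b} x"
  shows "continuous_on {a..b} x"
  unfolding continuous_on_iff
proof (intro ballI allI impI)
  fix t e :: real assume t: "t \<in> {a..b}" and e: "e > 0"
  obtain \<delta> where \<delta>: "\<delta> > 0" "\<And>d t. d division_of t \<Longrightarrow> t \<subseteq> {a..b} \<Longrightarrow>
      (\<Sum>k\<in>d. measure lborel k) < \<delta> \<Longrightarrow> (\<Sum>k\<in>d. norm (x (Sup k) - x (Inf k))) < e"
    using assms e unfolding abs_continuous_on_def by metis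
  have *: "norm (x v - x u) < e" if "u \<in> {a..b}" "v \<in> {a..b}" "u \<le> v" "v - u < \<delta>" for u v
  proof -
    have "{cbox u v} division_of cbox u v" using that by (intro division_of_self) auto
    from \<delta>(2)[OF this] show ?thesis using that by auto
  qed
  show "\<exists>d>0. \<forall>t'\<in>{a..b}. dist t' t < d \<longrightarrow> dist (x t') (x t) < e"
  proof (intro exI conjI ballI impI)
    fix t' assume t': "t' \<in> {a..b}" "dist t' t < \<delta>"
    then show "dist (x t') (x t) < e"
      using *[of t t'] *[of t' t] t by (cases "t \<le> t'") (auto simp: dist_norm norm_minus_commute)
  qed (use \<delta> in auto)
qed

lemma abs_continuous_on_subset:
  "abs_continuous_on S x \<Longrightarrow> T \<subseteq> S \<Longrightarrow> abs_continuous_on T x"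
  unfolding abs_continuous_on_def by (meson order_trans)

lemma abs_continuous_on_inner_right:
  fixes x :: "real \<Rightarrow> 'a::real_inner"
  assumes "abs_continuous_on S x"
  shows "abs_continuous_on S (\<lambda>t. p \<bullet> x t)"
  unfolding abs_continuous_on_def
proof (intro allI impI)
  fix \<epsilon> :: real assume \<epsilon>: "\<epsilon> > 0"
  have n: "norm p + 1 > 0" by (simp add: add_nonneg_pos)
  have "\<epsilon> / (norm p + 1) > 0" using \<epsilon> n by simp
  then obtain \<delta> where \<delta>: "\<delta> > 0" "\<And>d t. d division_of t \<Longrightarrow> t \<subseteq> S \<Longrightarrow>
      (\<Sum>k\<in>d. measure lborel k) < \<delta> \<Longrightarrow> (\<Sum>k\<in>d. norm (x (Sup k) - x (Inf k))) < \<epsilon> / (norm p + 1)"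
    using assms unfolding abs_continuous_on_def by metis
  show "\<exists>\<delta>>0. \<forall>d t. d division_of t \<and> t \<subseteq> S \<and> (\<Sum>k\<in>d. measure lborel k) < \<delta> \<longrightarrow>
        (\<Sum>k\<in>d. norm (p \<bullet> x (Sup k) - p \<bullet> x (Inf k))) < \<epsilon>"
  proof (intro exI[of _ \<delta>] conjI allI impI)
    fix d t assume dt: "d division_of t \<and> t \<subseteq> S \<and> (\<Sum>k\<in>d. measure lborel k) < \<delta>"
    have "norm (p \<bullet> x (Sup k) - p \<bullet> x (Inf k)) \<le> (norm p + 1) * norm (x (Sup k) - x (Inf k))" for k
    proof -
      have "norm (p \<bullet> x (Sup k) - p \<bullet> x (Inf k)) \<le> norm p * norm (x (Sup k) - x (Inf k))"
        using Cauchy_Schwarz_ineq2[of p "x (Sup k) - x (Inf k)"] by (simp add: inner_diff_right)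
      also have "\<dots> \<le> (norm p + 1) * norm (x (Sup k) - x (Inf k))"
        by (intro mult_right_mono) auto
      finally show ?thesis .
    qed
    then have "(\<Sum>k\<in>d. norm (p \<bullet> x (Sup k) - p \<bullet> x (Inf k)))
        \<le> (norm p + 1) * (\<Sum>k\<in>d. norm (x (Sup k) - x (Inf k)))"
      by (simp add: sum_distrib_left sum_mono)
    also have "\<dots> < \<epsilon>" using \<delta>(2)[of d t] dt n by (simp add: field_simps)
    finally show "(\<Sum>k\<in>d. norm (p \<bullet> x (Sup k) - p \<bullet> x (Inf k))) < \<epsilon>" .
  qed (use \<delta> in auto)
qed

lemma abs_continuous_inner_increment_le:
  fixes x :: "real \<Rightarrow> 'a::real_inner"
  assumes ac: "abs_continuous_on {a..b} x" and ab: "a \<le> b" and N: "negligible N"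
    and der: "\<And>t. t \<in> {a..b} - N \<Longrightarrow>
      \<exists>v. p \<bullet> v \<le> m \<and> (x has_vector_derivative v) (at t within {a..b})"
  shows "p \<bullet> (x b - x a) \<le> m * (b - a)"
proof -
  have "p \<bullet> x b - p \<bullet> x a \<le> m * (b - a)"
  proof (rule abs_continuous_increment_le[OF abs_continuous_on_inner_right[OF ac] ab N])
    fix t assume "t \<in> {a..b} - N"
    then obtain v where "p \<bullet> v \<le> m" "(x has_vector_derivative v) (at t within {a..b})"
      using der by blast
    then show "\<exists>D\<le>m. ((\<lambda>t. p \<bullet> x t) has_vector_derivative D) (at t within {a..b})"
      using bounded_linear.has_vector_derivative[OF bounded_linear_inner_right] by blast
  qed
  then show ?thesis by (simp add: inner_diff_right)
qed

text \<open>Testing with the unit vector in the direction of \<open>x b - x a\<close> reduces the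
  norm to the scalar inequality.\<close>

lemma abs_continuous_norm_increment_le:
  fixes x :: "real \<Rightarrow> 'a::real_inner"
  assumes ac: "abs_continuous_on {a..b} x" and ab: "a \<le> b" and N: "negligible N"
    and der: "\<And>t. t \<in> {a..b} - N \<Longrightarrow>
      \<exists>v. norm v \<le> M \<and> (x has_vector_derivative v) (at t within {a..b})"
  shows "norm (x b - x a) \<le> M * (b - a)"
proof -
  have "sgn (x b - x a) \<bullet> (x b - x a) \<le> M * (b - a)" if "x b \<noteq> x a"
  proof (rule abs_continuous_inner_increment_le[OF ac ab N])
    fix t assume "t \<in> {a..b} - N"
    then obtain v where v: "norm v \<le> M" "(x has_vector_derivative v) (at t within {a..b})"
      using der by blast
    have "sgn (x b - x a) \<bullet> v \<le> norm v"
      using norm_cauchy_schwarz[of "sgn (x b - x a)" v] that by (simp add: norm_sgn)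
    then show "\<exists>v. sgn (x b - x a) \<bullet> v \<le> M \<and> (x has_vector_derivative v) (at t within {a..b})"
      using v by (meson order_trans)
  qed
  moreover have "sgn (x b - x a) \<bullet> (x b - x a) = norm (x b - x a)"
    by (cases "x b = x a") (simp_all add: sgn_div_norm dot_square_norm power2_eq_square)
  \<comment> \<open>The sign of \<open>M\<close> is not given. A nondegenerate interval is not
    negligible, so some velocity with norm at most \<open>M\<close> exists, which forces
    \<open>0 \<le> M\<close>.\<close>
  moreover have "0 \<le> M * (b - a)" if "x b = x a"
  proof (cases "a < b")
    case True
    then have "\<not> {a..b} \<subseteq> N"
      using N negligible_subset[of N "cbox a b"] negligible_interval(1)[of a b] by auto
    then obtain t where "t \<in> {a..b} - N" by blast
    then have "0 \<le> M" using der norm_ge_zero order_trans by blast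
    then show ?thesis using ab by simp
  qed (use ab in simp)
  ultimately show ?thesis by (cases "x b = x a") auto
qed

section \<open>Trajectories\<close>

lemma trajectory_onI:
  assumes "abs_continuous_on S x" "negligible N"
    and "\<And>t. t \<in> S - N \<Longrightarrow> \<exists>v\<in>F (x t). (x has_vector_derivative v) (at t within S)"
  shows "trajectory_on F S x"
  unfolding trajectory_on_def eventually_ae_filter_negligible
proof (intro conjI exI[of _ N])
  show "{t. \<not> (t \<in> S \<longrightarrow> (\<exists>v\<in>F (x t). (x has_vector_derivative v) (at t within S)))} \<subseteq> N"
    using assms(3) by auto
qed (use assms in auto)

lemma trajectory_on_lipschitzI:
  assumes "L-lipschitz_on {a..b} x" "negligible N"
    and "\<And>t. t \<in> {a..b} - N \<Longrightarrow> \<exists>v\<in>F (x t). (x has_vector_derivative v) (at t within {a..b})"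
  shows "trajectory_on F {a..b} x"
  by (rule trajectory_onI[OF lipschitz_imp_abs_continuous_on[OF assms(1)] assms(2,3)])

lemma trajectory_onE:
  assumes "trajectory_on F S x"
  obtains N where "abs_continuous_on S x" "negligible N"
    "\<And>t. t \<in> S - N \<Longrightarrow> \<exists>v\<in>F (x t). (x has_vector_derivative v) (at t within S)"
proof -
  from assms obtain N where N: "abs_continuous_on S x" "negligible N"
    "{t. \<not> (t \<in> S \<longrightarrow> (\<exists>v \<in> F (x t). (x has_vector_derivative v) (at t within S)))} \<subseteq> N"
    unfolding trajectory_on_def eventually_ae_filter_negligible by (elim conjE exE)
  show ?thesis
  proof (rule that[OF N(1,2)])
    show "\<exists>v\<in>F (x t). (x has_vector_derivative v) (at t within S)" if "t \<in> S - N" for t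
      using subsetD[OF N(3), of t] that by auto
  qed
qed

lemma trajectory_on_subset:
  assumes "trajectory_on F S x" "T \<subseteq> S"
  shows "trajectory_on F T x"
proof -
  obtain N where N: "abs_continuous_on S x" "negligible N"
    "\<And>t. t \<in> S - N \<Longrightarrow> \<exists>v\<in>F (x t). (x has_vector_derivative v) (at t within S)"
    using trajectory_onE[OF assms(1)] by blast
  show ?thesis
  proof (rule trajectory_onI[OF abs_continuous_on_subset[OF N(1) assms(2)] N(2)])
    fix t assume "t \<in> T - N"
    then obtain v where "v \<in> F (x t)" "(x has_vector_derivative v) (at t within S)"
      using N(3)[of t] assms(2) by blast
    then show "\<exists>v\<in>F (x t). (x has_vector_derivative v) (at t within T)"
      using has_vector_derivative_within_subset[OF _ assms(2)] by blast
  qed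
qed

lemma linear_growth_bounded:
  assumes "linear_growth F"
  obtains M where "M \<ge> 0" "\<And>x v. norm x \<le> R \<Longrightarrow> v \<in> F x \<Longrightarrow> norm v \<le> M"
proof -
  obtain \<gamma> c where gc: "\<gamma> > 0" "c > 0" "\<And>x v. v \<in> F x \<Longrightarrow> norm v \<le> \<gamma> * norm x + c"
    using assms unfolding linear_growth_def by blast
  show ?thesis
  proof (rule that[of "\<gamma> * \<bar>R\<bar> + c"])
    show "0 \<le> \<gamma> * \<bar>R\<bar> + c" using gc by simp
    fix x v assume "norm x \<le> R" "v \<in> F x"
    have "norm v \<le> \<gamma> * norm x + c" by (rule gc) fact
    also have "\<dots> \<le> \<gamma> * \<bar>R\<bar> + c" using gc \<open>norm x \<le> R\<close> by auto
    finally show "norm v \<le> \<gamma> * \<bar>R\<bar> + c" .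
  qed
qed

text \<open>A trajectory is bounded on a compact interval, so linear growth bounds its velocities
  there. The Lipschitz property is easier than absolute continuity to carry through
  reparametrization and concatenation.\<close>

lemma trajectory_on_imp_lipschitz:
  assumes "linear_growth F" "trajectory_on F {a..b} x"
  obtains L where "L-lipschitz_on {a..b} x"
proof -
  obtain N where N: "abs_continuous_on {a..b} x" "negligible N"
    "\<And>t. t \<in> {a..b} - N \<Longrightarrow> \<exists>v\<in>F (x t). (x has_vector_derivative v) (at t within {a..b})"
    using trajectory_onE[OF assms(2)] by blast
  have "bounded (x ` {a..b})"
    using abs_continuous_on_imp_continuous_on[OF N(1)] compact_continuous_image compact_imp_bounded
    by blast
  then obtain R where R: "\<And>t. t \<in> {a..b} \<Longrightarrow> norm (x t) \<le> R" unfolding bounded_iff by blast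
  obtain M where M: "M \<ge> 0" "\<And>x v. norm x \<le> R \<Longrightarrow> v \<in> F x \<Longrightarrow> norm v \<le> M"
    using linear_growth_bounded[OF assms(1)] by blast
  have *: "norm (x v - x u) \<le> M * (v - u)" if "u \<in> {a..b}" "v \<in> {a..b}" "u \<le> v" for u v
  proof (rule abs_continuous_norm_increment_le[OF _ \<open>u \<le> v\<close> N(2)])
    have sub: "{u..v} \<subseteq> {a..b}" using that by auto
    show "abs_continuous_on {u..v} x" by (rule abs_continuous_on_subset[OF N(1) sub])
    fix t assume t: "t \<in> {u..v} - N"
    then obtain w where "w \<in> F (x t)" "(x has_vector_derivative w) (at t within {a..b})"
      using N(3)[of t] sub by blast
    then show "\<exists>v'. norm v' \<le> M \<and> (x has_vector_derivative v') (at t within {u..v})"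
      using M(2) R has_vector_derivative_within_subset[OF _ sub] t sub by (meson DiffD1 subsetD)
  qed
  have "M-lipschitz_on {a..b} x"
  proof (rule lipschitz_onI)
    fix u v assume "u \<in> {a..b}" "v \<in> {a..b}"
    then show "dist (x u) (x v) \<le> M * dist u v"
      using *[of u v] *[of v u]
      by (cases "u \<le> v") (auto simp: dist_norm norm_minus_commute)
  qed (rule M)
  then show ?thesis by (rule that)
qed

text \<open>Covers time shifts (\<open>\<sigma> = 1\<close>) and time reversal
  (\<open>\<sigma> = -1\<close>) at once; the chain rule multiplies velocities by
  \<open>\<sigma>\<close>.\<close>

lemma trajectory_on_affine:
  fixes \<sigma> c :: real
  assumes lg: "linear_growth F" and tr: "trajectory_on F {a..b} x" and \<sigma>: "\<bar>\<sigma>\<bar> = 1"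
    and im: "(\<lambda>t. \<sigma> * t + c) ` {a'..b'} \<subseteq> {a..b}"
  shows "trajectory_on (\<lambda>z. (*\<^sub>R) \<sigma> ` F z) {a'..b'} (\<lambda>t. x (\<sigma> * t + c))"
proof -
  obtain L where L: "L-lipschitz_on {a..b} x"
    using trajectory_on_imp_lipschitz[OF lg tr] by blast
  obtain N where N: "abs_continuous_on {a..b} x" "negligible N"
    "\<And>t. t \<in> {a..b} - N \<Longrightarrow> \<exists>v\<in>F (x t). (x has_vector_derivative v) (at t within {a..b})"
    using trajectory_onE[OF tr] by blast
  \<comment> \<open>The preimage of \<open>N\<close> under the change of time, written as an image
    under the inverse map: \<open>\<sigma>\<close> is its own reciprocal, and smooth images of
    negligible sets are negligible.\<close>
  define N' where "N' = (\<lambda>t. \<sigma> * t - \<sigma> * c) ` N"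
  have "\<sigma> * \<sigma> = 1" using \<sigma> by (metis abs_mult_self_eq mult_1)
  then have inv: "\<sigma> * (\<sigma> * t + c) - \<sigma> * c = t" for t by (simp add: algebra_simps flip: mult.assoc)
  show ?thesis
  proof (rule trajectory_on_lipschitzI)
    show "L-lipschitz_on {a'..b'} (\<lambda>t. x (\<sigma> * t + c))"
    proof (rule lipschitz_onI)
      fix u v assume uv: "u \<in> {a'..b'}" "v \<in> {a'..b'}"
      have "dist (x (\<sigma> * u + c)) (x (\<sigma> * v + c)) \<le> L * dist (\<sigma> * u + c) (\<sigma> * v + c)"
        using uv im by (intro lipschitz_onD[OF L]) blast+
      also have "dist (\<sigma> * u + c) (\<sigma> * v + c) = \<bar>\<sigma>\<bar> * dist u v"
        by (simp add: dist_real_def abs_mult flip: right_diff_distrib)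
      finally show "dist (x (\<sigma> * u + c)) (x (\<sigma> * v + c)) \<le> L * dist u v" using \<sigma> by simp
    qed (rule lipschitz_on_nonneg[OF L])
    show "negligible N'" unfolding N'_def
      by (intro negligible_differentiable_image_negligible N(2)) (auto intro!: derivative_intros simp: differentiable_on_def)
    fix t assume t: "t \<in> {a'..b'} - N'"
    have "\<sigma> * t + c \<notin> N"
    proof
      assume "\<sigma> * t + c \<in> N"
      then have "\<sigma> * (\<sigma> * t + c) - \<sigma> * c \<in> N'" unfolding N'_def by blast
      then show False using inv t by simp
    qed
    then obtain v where v: "v \<in> F (x (\<sigma> * t + c))" "(x has_vector_derivative v) (at (\<sigma> * t + c) within {a..b})"
      using N(3)[of "\<sigma> * t + c"] t im by blast
    have "((\<lambda>t. \<sigma> * t + c) has_vector_derivative \<sigma>) (at t within {a'..b'})"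
      by (auto intro!: derivative_eq_intros simp flip: has_real_derivative_iff_has_vector_derivative)
    from vector_diff_chain_within[OF this has_vector_derivative_within_subset[OF v(2) im]]
    show "\<exists>w\<in>(*\<^sub>R) \<sigma> ` F (x (\<sigma> * t + c)). ((\<lambda>t. x (\<sigma> * t + c)) has_vector_derivative w) (at t within {a'..b'})"
      using v(1) by (auto simp: o_def)
  qed
qed

lemma trajectory_on_concat:
  assumes lg: "linear_growth F" and x: "trajectory_on F {a..b} x" and y: "trajectory_on F {b..c} y"
    and ab: "a \<le> b" and bc: "b \<le> c" and xy: "x b = y b"
  shows "trajectory_on F {a..c} (\<lambda>t. if t \<le> b then x t else y t)"
    (is "trajectory_on F _ ?z")
proof -
  obtain L where L: "L-lipschitz_on {a..b} x"
    using trajectory_on_imp_lipschitz[OF lg x] by blast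
  obtain M where M: "M-lipschitz_on {b..c} y"
    using trajectory_on_imp_lipschitz[OF lg y] by blast
  obtain N where N: "negligible N"
    "\<And>t. t \<in> {a..b} - N \<Longrightarrow> \<exists>v\<in>F (x t). (x has_vector_derivative v) (at t within {a..b})"
    using trajectory_onE[OF x] by blast
  obtain P where P: "negligible P"
    "\<And>t. t \<in> {b..c} - P \<Longrightarrow> \<exists>v\<in>F (y t). (y has_vector_derivative v) (at t within {b..c})"
    using trajectory_onE[OF y] by blast
  show ?thesis
  proof (rule trajectory_on_lipschitzI)
    show "(max L M)-lipschitz_on {a..c} ?z" by (rule lipschitz_on_concat_max[OF L M xy])
    \<comment> \<open>At the junction \<open>b\<close> the two one-sided velocities may differ, so
      \<open>b\<close> joins the exceptional set. Away from it the curve agrees locally with one of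
      the pieces.\<close>
    show "negligible (insert b (N \<union> P))" using N(1) P(1) by simp
    fix t assume t: "t \<in> {a..c} - insert b (N \<union> P)"
    show "\<exists>v\<in>F (?z t). (?z has_vector_derivative v) (at t within {a..c})"
    proof (cases "t < b")
      case True
      then obtain v where v: "v \<in> F (x t)" "(x has_vector_derivative v) (at t within {a..b})"
        using N(2)[of t] t by auto
      have "(?z has_vector_derivative v) (at t within {a..b})"
        by (rule has_vector_derivative_transform[OF _ _ v(2)]) (use t True bc in auto)
      moreover have "at t within {a..b} = at t within {a..c}"
        by (rule at_within_nhd[of _ "{..<b}"]) (use t True bc in auto)
      ultimately show ?thesis using v True by auto
    next
      case False
      then obtain v where v: "v \<in> F (y t)" "(y has_vector_derivative v) (at t within {b..c})"
        using P(2)[of t] t by auto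
      have bt: "b < t" using t False by auto
      have "(?z has_vector_derivative v) (at t within {b..c})"
        by (rule has_vector_derivative_transform[OF _ _ v(2)]) (use t bt xy in auto)
      moreover have "at t within {b..c} = at t within {a..c}"
        by (rule at_within_nhd[of _ "{b<..}"]) (use t bt ab in auto)
      ultimately show ?thesis using v bt by auto
    qed
  qed
qed

section \<open>Reachability in an exact time: splitting, composition and time reversal\<close>

definition reaches :: "'n::finite multifunction \<Rightarrow> real \<Rightarrow> real ^ 'n \<Rightarrow> real ^ 'n \<Rightarrow> bool" where
  "reaches F \<tau> x y \<longleftrightarrow> 0 \<le> \<tau> \<and> (\<exists>z. trajectory_on F {0..\<tau>} z \<and> z 0 = x \<and> z \<tau> = y)"

lemma reaches_split:
  assumes "linear_growth F" "reaches F \<tau> x y" "0 \<le> s" "s \<le> \<tau>"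
  obtains z where "reaches F s x z" "reaches F (\<tau> - s) z y"
proof -
  obtain z where z: "trajectory_on F {0..\<tau>} z" "z 0 = x" "z \<tau> = y"
    using assms(2) unfolding reaches_def by blast
  have "trajectory_on F {0..s} z" by (rule trajectory_on_subset[OF z(1)]) (use assms in auto)
  then have "reaches F s x (z s)" unfolding reaches_def using z(2) assms(3) by blast
  moreover have "trajectory_on (\<lambda>z. (*\<^sub>R) 1 ` F z) {0..\<tau> - s} (\<lambda>t. z (1 * t + s))"
    using assms by (intro trajectory_on_affine[OF assms(1) z(1)]) auto
  then have "reaches F (\<tau> - s) (z s) y" unfolding reaches_def
    using z(3) assms(4) by (intro conjI exI[of _ "\<lambda>t. z (t + s)"]) simp_all
  ultimately show ?thesis by (rule that)
qed

lemma reaches_trans: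
  assumes "linear_growth F" "reaches F s x z" "reaches F t z y"
  shows "reaches F (s + t) x y"
proof -
  obtain u where u: "trajectory_on F {0..s} u" "u 0 = x" "u s = z"
    using assms(2) unfolding reaches_def by blast
  obtain w where w: "trajectory_on F {0..t} w" "w 0 = z" "w t = y"
    using assms(3) unfolding reaches_def by blast
  have st: "0 \<le> s" "0 \<le> t" using assms unfolding reaches_def by auto
  have "trajectory_on (\<lambda>z. (*\<^sub>R) 1 ` F z) {s..s + t} (\<lambda>r. w (1 * r + (- s)))"
    by (intro trajectory_on_affine[OF assms(1) w(1)]) auto
  then have "trajectory_on F {s..s + t} (\<lambda>r. w (r - s))" by simp
  then have "trajectory_on F {0..s + t} (\<lambda>r. if r \<le> s then u r else w (r - s))"
    using u w st by (intro trajectory_on_concat[OF assms(1)]) auto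
  then show ?thesis unfolding reaches_def using st u w
    by (intro conjI exI[of _ "\<lambda>r. if r \<le> s then u r else w (r - s)"]) auto
qed

lemma linear_growth_uminus:
  "linear_growth F \<Longrightarrow> linear_growth (\<lambda>x. uminus ` F x)"
  unfolding linear_growth_def by simp

text \<open>Running a curve backwards negates its velocities. This symmetry turns results on leaving
  a point into results on arriving there, and moves the analysis from the initial to the final
  endpoint.\<close>

lemma reaches_uminus:
  assumes "linear_growth F" "reaches F \<tau> x y"
  shows "reaches (\<lambda>x. uminus ` F x) \<tau> y x"
proof -
  obtain z where z: "trajectory_on F {0..\<tau>} z" "z 0 = x" "z \<tau> = y"
    using assms(2) unfolding reaches_def by blast
  have "trajectory_on (\<lambda>z. (*\<^sub>R) (-1) ` F z) {0..\<tau>} (\<lambda>t. z (-1 * t + \<tau>))"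
    by (intro trajectory_on_affine[OF assms(1) z(1)]) auto
  moreover have "(*\<^sub>R) (-1) = (uminus :: real ^ 'a \<Rightarrow> _)" by auto
  ultimately have "trajectory_on (\<lambda>z. uminus ` F z) {0..\<tau>} (\<lambda>t. z (\<tau> - t))" by simp
  then show ?thesis using z assms(2) unfolding reaches_def
    by (intro conjI exI[of _ "\<lambda>t. z (\<tau> - t)"]) simp_all
qed

lemma reaches_uminus_iff:
  assumes "linear_growth F"
  shows "reaches (\<lambda>x. uminus ` F x) \<tau> y x \<longleftrightarrow> reaches F \<tau> x y"
  using reaches_uminus[OF assms, of \<tau> x y]
    reaches_uminus[OF linear_growth_uminus[OF assms], of \<tau> y x] by (auto simp: image_image)

lemma min_time_eq: "min_time F x y = Inf {ereal \<tau> | \<tau>. reaches F \<tau> x y}"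
  unfolding min_time_def reaches_def by simp

lemma min_time_le: "reaches F \<tau> x y \<Longrightarrow> min_time F x y \<le> ereal \<tau>"
  unfolding min_time_eq by (rule Inf_lower) blast

lemma min_time_less_imp_reaches:
  assumes "min_time F x y < ereal t"
  obtains \<tau> where "\<tau> < t" "reaches F \<tau> x y"
  using assms unfolding min_time_eq Inf_less_iff by auto

lemma min_time_nonneg: "0 \<le> min_time F x y"
  unfolding min_time_eq by (rule Inf_greatest) (auto simp: reaches_def)

lemma min_time_uminus:
  "linear_growth F \<Longrightarrow> min_time (\<lambda>x. uminus ` F x) y x = min_time F x y"
  by (simp add: min_time_eq reaches_uminus_iff)

section \<open>Filippov trajectories\<close>

text \<open>Trades the inclusion for the selection of a nearby velocity. The absolute value is taken
  because the definition leaves the sign of the constant open.\<close>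

lemma locally_LipschitzE:
  assumes "locally_Lipschitz F" "compact K"
  obtains L where "L \<ge> 0"
    "\<And>x y v. x \<in> K \<Longrightarrow> y \<in> K \<Longrightarrow> v \<in> F x \<Longrightarrow> \<exists>w\<in>F y. norm (v - w) \<le> L * norm (x - y)"
proof -
  from assms obtain L where L: "\<forall>x\<in>K. \<forall>y\<in>K.
      F x \<subseteq> {v + (L * norm (y - x)) *\<^sub>R b | v b. v \<in> F y \<and> b \<in> cball 0 1}"
    unfolding locally_Lipschitz_def by (elim allE[of _ K] impE exE)
  show ?thesis
  proof (rule that[of "\<bar>L\<bar>"])
    fix x y v assume *: "x \<in> K" "y \<in> K" "v \<in> F x"
    have "v \<in> {v + (L * norm (y - x)) *\<^sub>R b | v b. v \<in> F y \<and> b \<in> cball 0 1}"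
      using L[rule_format, OF *(1,2)] *(3) by (rule subsetD)
    then obtain w b where wb: "v = w + (L * norm (y - x)) *\<^sub>R b" "w \<in> F y" "norm b \<le> 1"
      by auto
    have "norm (v - w) = \<bar>L\<bar> * norm (x - y) * norm b"
      using wb by (simp add: abs_mult norm_minus_commute)
    also have "\<dots> \<le> \<bar>L\<bar> * norm (x - y)" using wb by (intro mult_left_le) auto
    finally show "\<exists>w\<in>F y. norm (v - w) \<le> \<bar>L\<bar> * norm (x - y)" using wb by blast
  qed simp
qed

text \<open>Each projection satisfies an obtuse angle inequality over its own set. Testing it at a
  point within \<open>\<eta>\<close> of the other projection and adding both inequalities gives the
  bound. The dependence on the sets is only of order 1/2, which is enough for continuity.\<close>

lemma closest_point_Hausdorff_le:
  fixes C D :: "'a::euclidean_space set"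
  assumes C: "convex C" "closed C" "C \<noteq> {}" and D: "convex D" "closed D" "D \<noteq> {}"
    and CD: "\<And>p. p \<in> C \<Longrightarrow> \<exists>q\<in>D. norm (p - q) \<le> \<eta>"
    and DC: "\<And>p. p \<in> D \<Longrightarrow> \<exists>q\<in>C. norm (p - q) \<le> \<eta>"
  shows "(norm (closest_point C w - closest_point D w))\<^sup>2 \<le>
    \<eta> * (norm (w - closest_point C w) + norm (w - closest_point D w))"
proof -
  define p where "p = closest_point C w"
  define q where "q = closest_point D w"
  have "p \<in> C" "q \<in> D" unfolding p_def q_def using C D closest_point_in_set by auto
  obtain p' where p': "p' \<in> D" "norm (p - p') \<le> \<eta>" using CD \<open>p \<in> C\<close> by blast
  obtain q' where q': "q' \<in> C" "norm (q - q') \<le> \<eta>" using DC \<open>q \<in> D\<close> by blast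
  have "(w - q) \<bullet> (p' - q) \<le> 0" unfolding q_def by (rule closest_point_dot[OF D(1,2) p'(1)])
  moreover have "(w - p) \<bullet> (q' - p) \<le> 0" unfolding p_def by (rule closest_point_dot[OF C(1,2) q'(1)])
  moreover have "(w - q) \<bullet> (p - p') \<le> norm (w - q) * \<eta>"
    by (meson norm_cauchy_schwarz mult_left_mono norm_ge_zero order_trans p'(2))
  moreover have "(w - p) \<bullet> (q - q') \<le> norm (w - p) * \<eta>"
    by (meson norm_cauchy_schwarz mult_left_mono norm_ge_zero order_trans q'(2))
  \<comment> \<open>The points \<open>p'\<close> and \<open>q'\<close> cancel, leaving
    \<open>(w - q) \<bullet> (p - q) + (w - p) \<bullet> (q - p)\<close>, which is the
    square.\<close>
  moreover have "(norm (p - q))\<^sup>2 = (w - q) \<bullet> (p' - q) + (w - p) \<bullet> (q' - p)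
      + (w - q) \<bullet> (p - p') + (w - p) \<bullet> (q - q')"
    unfolding power2_norm_eq_inner by (simp add: algebra_simps inner_commute)
  ultimately show ?thesis unfolding p_def[symmetric] q_def[symmetric] by (simp add: algebra_simps)
qed

text \<open>The change splits in two: projection onto a fixed convex set is nonexpansive, and for a
  fixed point the change of set is controlled by the Hausdorff estimate with distance
  \<open>\<eta> t\<close>. The factor \<open>2 * B + \<eta> t\<close> arises because the distance
  from \<open>w t0\<close> to the moved set is at most \<open>B + \<eta> t\<close>.\<close>

lemma continuous_on_closest_point_multifunction:
  assumes F: "compact_convex_valued F" and L: "L \<ge> 0"
    "\<And>x y v. x \<in> K \<Longrightarrow> y \<in> K \<Longrightarrow> v \<in> F x \<Longrightarrow> \<exists>w\<in>F y. norm (v - w) \<le> L * norm (x - y)"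
    and x: "continuous_on S x" "x ` S \<subseteq> K" and w: "continuous_on S w"
  shows "continuous_on S (\<lambda>t. closest_point (F (x t)) (w t))"
  unfolding continuous_on_def
proof
  fix t0 assume t0: "t0 \<in> S"
  have F': "convex (F y)" "closed (F y)" "F y \<noteq> {}" for y
    using F compact_imp_closed unfolding compact_convex_valued_def by auto
  define P where "P t = closest_point (F (x t))" for t
  define B where "B = norm (w t0 - P t0 (w t0))"
  define \<eta> where "\<eta> t = L * norm (x t - x t0)" for t
  have bound: "norm (P t (w t) - P t0 (w t0)) \<le> norm (w t - w t0) + sqrt (\<eta> t * (2 * B + \<eta> t))"
    if t: "t \<in> S" for t
  proof -
    have "norm (P t (w t) - P t (w t0)) \<le> norm (w t - w t0)"
      unfolding P_def using closest_point_lipschitz[OF F'] by (simp add: dist_norm)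
    moreover have "norm (P t (w t0) - P t0 (w t0)) \<le> sqrt (\<eta> t * (2 * B + \<eta> t))"
    proof (rule real_le_rsqrt)
      have "P t0 (w t0) \<in> F (x t0)" unfolding P_def by (rule closest_point_in_set[OF F'(2,3)])
      then obtain p where p: "p \<in> F (x t)" "norm (P t0 (w t0) - p) \<le> \<eta> t"
        using L(2)[of "x t0" "x t"] x(2) t t0 unfolding \<eta>_def
        by (metis image_subset_iff norm_minus_commute)
      have "norm (w t0 - P t (w t0)) \<le> norm (w t0 - p)"
        unfolding P_def using closest_point_le[OF F'(2) p(1)] by (simp add: dist_norm)
      also have "\<dots> \<le> B + \<eta> t"
        unfolding B_def using p(2) norm_triangle_ineq[of "w t0 - P t0 (w t0)" "P t0 (w t0) - p"] by simp
      finally have 1: "norm (w t0 - P t (w t0)) \<le> B + \<eta> t" .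
      have "(norm (P t (w t0) - P t0 (w t0)))\<^sup>2 \<le> \<eta> t * (norm (w t0 - P t (w t0)) + norm (w t0 - P t0 (w t0)))"
        unfolding P_def
      proof (rule closest_point_Hausdorff_le[OF F' F'])
        show "\<exists>q\<in>F (x t0). norm (p - q) \<le> \<eta> t" if "p \<in> F (x t)" for p
          using L(2)[OF _ _ that, of "x t0"] x(2) t t0 by (auto simp: \<eta>_def)
        show "\<exists>q\<in>F (x t). norm (p - q) \<le> \<eta> t" if "p \<in> F (x t0)" for p
          using L(2)[OF _ _ that, of "x t"] x(2) t t0 by (auto simp: \<eta>_def norm_minus_commute)
      qed
      also have "\<dots> \<le> \<eta> t * (2 * B + \<eta> t)"
        using 1 L(1) by (intro mult_left_mono) (auto simp: B_def \<eta>_def)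
      finally show "(norm (P t (w t0) - P t0 (w t0)))\<^sup>2 \<le> \<eta> t * (2 * B + \<eta> t)" .
    qed
    ultimately show ?thesis
      using norm_triangle_ineq[of "P t (w t) - P t (w t0)" "P t (w t0) - P t0 (w t0)"] by simp
  qed
  have xt: "(x \<longlongrightarrow> x t0) (at t0 within S)" "(w \<longlongrightarrow> w t0) (at t0 within S)"
    using x(1) w t0 by (auto simp: continuous_on_def)
  have "((\<lambda>t. norm (w t - w t0) + sqrt (\<eta> t * (2 * B + \<eta> t))) \<longlongrightarrow>
      norm (w t0 - w t0) + sqrt ((L * norm (x t0 - x t0)) * (2 * B + (L * norm (x t0 - x t0))))) (at t0 within S)"
    unfolding \<eta>_def by (intro tendsto_intros xt)
  then have "((\<lambda>t. norm (w t - w t0) + sqrt (\<eta> t * (2 * B + \<eta> t))) \<longlongrightarrow> 0) (at t0 within S)" by simp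
  then have "((\<lambda>t. P t (w t) - P t0 (w t0)) \<longlongrightarrow> 0) (at t0 within S)"
    by (rule Lim_null_comparison[rotated]) (auto simp: eventually_at_filter bound)
  then show "((\<lambda>t. closest_point (F (x t)) (w t)) \<longlongrightarrow> closest_point (F (x t0)) (w t0)) (at t0 within S)"
    unfolding P_def by (simp add: LIM_zero_iff)
qed

text \<open>Projecting the previous velocity, rather than a fixed one, bounds each change of velocity by
  the Lipschitz constant times the previous change of position, so the iteration contracts on short
  intervals; since the projections are continuous in time, so is the limiting velocity.\<close>

primrec filippov_velocity ::
    "'n::finite multifunction \<Rightarrow> real ^ 'n \<Rightarrow> real ^ 'n \<Rightarrow> nat \<Rightarrow> real \<Rightarrow> real ^ 'n" where
  "filippov_velocity F x v 0 = (\<lambda>t. v)"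
| "filippov_velocity F x v (Suc k) = (\<lambda>t.
     closest_point (F (x + integral {0..t} (filippov_velocity F x v k))) (filippov_velocity F x v k t))"

lemma norm_integral_diff_le:
  fixes f g :: "real \<Rightarrow> 'a::euclidean_space"
  assumes "continuous_on {0..s} f" "continuous_on {0..s} g" "t \<in> {0..s}"
    and "\<And>u. u \<in> {0..s} \<Longrightarrow> norm (f u - g u) \<le> B"
  shows "norm (integral {0..t} f - integral {0..t} g) \<le> B * t"
proof -
  have c: "continuous_on {0..t} f" "continuous_on {0..t} g"
    using assms(1-3) by (auto intro: continuous_on_subset)
  have "integral {0..t} f - integral {0..t} g = integral {0..t} (\<lambda>u. f u - g u)"
    using c by (intro integral_diff[symmetric] integrable_continuous_real)
  also have "norm \<dots> \<le> B * (t - 0)"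
    using assms(3,4) c by (intro integral_bound continuous_intros) auto
  finally show ?thesis by simp
qed

text \<open>\<open>A\<close> bounds the first correction of the velocity \<open>v\<close>, made at
  distance at most \<open>norm (x - \<alpha>) + s * norm v\<close> from \<open>\<alpha>\<close>. As
  \<open>L * s \<le> 1/2\<close>, each later correction is at most half of the previous bound, so
  the total is at most \<open>2 * A\<close>. The assumption \<open>stay\<close> keeps all iterates
  in the unit ball, where \<open>L\<close> is valid.\<close>

lemma filippov_reaches:
  fixes v x \<alpha> :: "real ^ 'n::finite"
  assumes F: "compact_convex_valued F" and v: "v \<in> F \<alpha>" and L: "L \<ge> 0"
    "\<And>x y v. x \<in> cball \<alpha> 1 \<Longrightarrow> y \<in> cball \<alpha> 1 \<Longrightarrow> v \<in> F x \<Longrightarrow> \<exists>w\<in>F y. norm (v - w) \<le> L * norm (x - y)"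
    and s: "0 \<le> s" "L * s \<le> 1/2"
    and A: "A = L * (norm (x - \<alpha>) + s * norm v)"
    and stay: "norm (x - \<alpha>) + s * (norm v + 2 * A) \<le> 1"
  shows "\<exists>z. reaches F s x z \<and> norm (z - x - s *\<^sub>R v) \<le> 2 * A * s"
proof -
  have F': "convex (F y)" "closed (F y)" "F y \<noteq> {}" for y
    using F compact_imp_closed unfolding compact_convex_valued_def by auto
  define V where "V = filippov_velocity F x v"
  define X where "X k t = x + integral {0..t} (V k)" for k t
  have A0: "A \<ge> 0" using A L s by simp
  have V0: "V 0 = (\<lambda>t. v)" by (simp add: V_def)
  have VS: "V (Suc k) = (\<lambda>t. closest_point (F (X k t)) (V k t))" for k
    by (simp add: V_def X_def)
  have VF: "V (Suc k) t \<in> F (X k t)" for k t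
    unfolding VS by (rule closest_point_in_set[OF F'(2,3)])
  have near: "norm (x + integral {0..t} f - \<alpha>) \<le> 1"
    if "t \<in> {0..s}" "continuous_on {0..s} f" "\<And>u. u \<in> {0..s} \<Longrightarrow> norm (f u - v) \<le> 2 * A" for t f
  proof -
    have "norm (integral {0..t} f - integral {0..t} (\<lambda>_. v)) \<le> 2 * A * t"
      by (rule norm_integral_diff_le[OF that(2) _ that(1,3)]) auto
    moreover have "integral {0..t} (\<lambda>_. v) = t *\<^sub>R v" using that(1) by simp
    ultimately have 1: "norm (integral {0..t} f - t *\<^sub>R v) \<le> 2 * A * t" by metis
    have "x + integral {0..t} f - \<alpha> = (x - \<alpha>) + t *\<^sub>R v + (integral {0..t} f - t *\<^sub>R v)" by simp
    also have "norm \<dots> \<le> norm (x - \<alpha>) + norm (t *\<^sub>R v) + 2 * A * t"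
      by (intro norm_triangle_le add_mono norm_triangle_ineq 1)
    also have "\<dots> = norm (x - \<alpha>) + t * (norm v + 2 * A)" using that(1) by (simp add: algebra_simps)
    also have "\<dots> \<le> norm (x - \<alpha>) + s * (norm v + 2 * A)"
      using that(1) A0 by (intro add_left_mono mult_right_mono) auto
    finally show ?thesis using stay by linarith
  qed
  \<comment> \<open>A velocity admissible at \<open>y\<close> is moved little by projection onto the
    velocities at \<open>X k t\<close>. Used with \<open>y = \<alpha>\<close> for the first
    correction and with the previous curve afterwards.\<close>
  have step: "norm (V (Suc k) t - V k t) \<le> L * norm (y - X k t)"
    if mem: "V k t \<in> F y" "y \<in> cball \<alpha> 1" "X k t \<in> cball \<alpha> 1" for k t y
  proof -
    obtain w where w: "w \<in> F (X k t)" "norm (V k t - w) \<le> L * norm (y - X k t)"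
      using L(2)[OF mem(2,3,1)] by blast
    then show ?thesis
      using closest_point_le[OF F'(2) w(1), of "V k t"] by (simp add: VS dist_norm norm_minus_commute)
  qed
  \<comment> \<open>\<open>2 - 2 / 2 ^ k\<close> is the sum of the first \<open>k\<close> terms of
    the geometric series with ratio 1/2.\<close>
  have bnd: "continuous_on {0..s} (V k) \<and> (\<forall>t\<in>{0..s}. norm (V k t - v) \<le> A * (2 - 2 / 2 ^ k) \<and>
      norm (V (Suc k) t - V k t) \<le> A / 2 ^ k)" for k
  proof (induction k)
    case 0
    show ?case
    proof (intro conjI ballI)
      fix t assume t: "t \<in> {0..s}"
      show "norm (V 0 t - v) \<le> A * (2 - 2 / 2 ^ 0)" by (simp add: V0)
      have X0: "X 0 t = x + t *\<^sub>R v" using t by (simp add: X_def V0)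
      have "X 0 t \<in> cball \<alpha> 1" unfolding X_def
        using near[OF t, of "V 0"] A0 by (simp add: V0 dist_norm norm_minus_commute)
      then have "norm (V (Suc 0) t - V 0 t) \<le> L * norm (\<alpha> - X 0 t)"
        using v by (intro step) (auto simp: V0)
      also have "norm (\<alpha> - X 0 t) \<le> norm (x - \<alpha>) + t * norm v"
        using norm_triangle_ineq[of "x - \<alpha>" "t *\<^sub>R v"] t unfolding X0
        by (simp add: norm_minus_commute algebra_simps)
      also have "\<dots> \<le> norm (x - \<alpha>) + s * norm v" using t by (auto intro: mult_right_mono)
      finally show "norm (V (Suc 0) t - V 0 t) \<le> A / 2 ^ 0" using L(1) A by (simp add: mult_left_mono)
    qed (simp add: V0)
  next
    case (Suc k)
    then have ck: "continuous_on {0..s} (V k)" by simp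
    have V2: "norm (V k t - v) \<le> 2 * A" if "t \<in> {0..s}" for t
    proof -
      have "norm (V k t - v) \<le> A * (2 - 2 / 2 ^ k)" using Suc that by blast
      also have "\<dots> \<le> A * 2" using A0 by (intro mult_left_mono) auto
      finally show ?thesis by simp
    qed
    have Xk: "X k t \<in> cball \<alpha> 1" if "t \<in> {0..s}" for t
      unfolding X_def using near[OF that ck V2] by (simp add: dist_norm norm_minus_commute)
    have Xc: "continuous_on {0..s} (X k)"
      unfolding X_def using ck
      by (intro continuous_intros indefinite_integral_continuous_1 integrable_continuous_real)
    have cS: "continuous_on {0..s} (V (Suc k))"
      unfolding VS using Xk
      by (intro continuous_on_closest_point_multifunction[OF F L Xc _ ck, where K = "cball \<alpha> 1"]) auto
    have bS: "norm (V (Suc k) t - v) \<le> A * (2 - 2 / 2 ^ Suc k)" if "t \<in> {0..s}" for t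
    proof -
      have "norm (V (Suc k) t - v) \<le> A / 2 ^ k + A * (2 - 2 / 2 ^ k)"
        using Suc that norm_triangle_ineq[of "V (Suc k) t - V k t" "V k t - v"] by fastforce
      then show ?thesis by (simp add: algebra_simps)
    qed
    have V2': "norm (V (Suc k) t - v) \<le> 2 * A" if "t \<in> {0..s}" for t
    proof -
      note bS[OF that]
      also have "A * (2 - 2 / 2 ^ Suc k) \<le> A * 2" using A0 by (intro mult_left_mono) auto
      finally show ?thesis by simp
    qed
    have XSk: "X (Suc k) t \<in> cball \<alpha> 1" if "t \<in> {0..s}" for t
      unfolding X_def using near[OF that cS V2'] by (simp add: dist_norm norm_minus_commute)
    show ?case
    proof (intro conjI ballI cS bS)
      fix t assume t: "t \<in> {0..s}"
      have "norm (V (Suc (Suc k)) t - V (Suc k) t) \<le> L * norm (X k t - X (Suc k) t)"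
        using VF Xk XSk t by (intro step)
      also have "norm (X k t - X (Suc k) t) \<le> A / 2 ^ k * t"
        unfolding X_def using Suc norm_integral_diff_le[OF ck cS t, of "A / 2 ^ k"]
        by (auto simp: norm_minus_commute)
      also have "A / 2 ^ k * t \<le> A / 2 ^ k * s" using t A0 by (intro mult_left_mono) auto
      also have "L * (A / 2 ^ k * s) = (L * s) * (A / 2 ^ k)" by simp
      also have "\<dots> \<le> 1/2 * (A / 2 ^ k)" using s A0 by (intro mult_right_mono) auto
      finally show "norm (V (Suc (Suc k)) t - V (Suc k) t) \<le> A / 2 ^ Suc k"
        using L(1) by (simp add: mult_left_mono)
    qed auto
  qed
  have Vc: "continuous_on {0..s} (V k)" for k using bnd by blast
  have V2: "norm (V k t - v) \<le> 2 * A" if "t \<in> {0..s}" for k t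
  proof -
    have "norm (V k t - v) \<le> A * (2 - 2 / 2 ^ k)" using bnd that by blast
    also have "\<dots> \<le> A * 2" using A0 by (intro mult_left_mono) auto
    finally show ?thesis by simp
  qed
  \<comment> \<open>The limit velocity is a telescoping series, so the Weierstrass test gives
    uniform convergence and hence continuity of \<open>W\<close>.\<close>
  define W where "W t = v + (\<Sum>i. V (Suc i) t - V i t)" for t
  have "summable (\<lambda>i. A / 2 ^ i)"
    using summable_mult[OF summable_geometric[of "1/2::real"], of A] by (simp add: power_one_over field_simps)
  then have "uniform_limit {0..s} (\<lambda>n t. \<Sum>i<n. V (Suc i) t - V i t) (\<lambda>t. \<Sum>i. V (Suc i) t - V i t) sequentially"
    using bnd by (intro Weierstrass_m_test) auto
  then have "uniform_limit {0..s} (\<lambda>n t. v + (\<Sum>i<n. V (Suc i) t - V i t)) W sequentially"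
    unfolding W_def by (intro uniform_limit_intros)
  moreover have "v + (\<Sum>i<n. V (Suc i) t - V i t) = V n t" for n t
    using sum_lessThan_telescope[of "\<lambda>i. V i t" n] by (simp add: V0)
  ultimately have ul: "uniform_limit {0..s} V W sequentially" by simp
  have Wc: "continuous_on {0..s} W"
    by (rule uniform_limit_theorem[OF _ ul]) (simp_all add: Vc)
  have VW: "(\<lambda>n. V n t) \<longlonglongrightarrow> W t" if "t \<in> {0..s}" for t
    using tendsto_uniform_limitI[OF ul that] .
  have W2: "norm (W t - v) \<le> 2 * A" if "t \<in> {0..s}" for t
    by (rule tendsto_upperbound[OF tendsto_norm[OF tendsto_diff[OF VW[OF that] tendsto_const]]])
      (auto simp: V2[OF that])
  define Y where "Y t = x + integral {0..t} W" for t
  have YK: "Y t \<in> cball \<alpha> 1" and XK: "X n t \<in> cball \<alpha> 1" if "t \<in> {0..s}" for t n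
    unfolding Y_def X_def using near[OF that Wc W2] near[OF that Vc V2]
    by (simp_all add: dist_norm norm_minus_commute)
  have XY: "(\<lambda>n. X n t) \<longlonglongrightarrow> Y t" if t: "t \<in> {0..s}" for t
  proof (rule tendstoI)
    fix e :: real assume e: "e > 0"
    have "\<forall>\<^sub>F n in sequentially. \<forall>u\<in>{0..s}. dist (V n u) (W u) < e / (s + 1)"
      using e s by (intro uniform_limitD[OF ul]) auto
    then show "\<forall>\<^sub>F n in sequentially. dist (X n t) (Y t) < e"
    proof eventually_elim
      case (elim n)
      have "dist (X n t) (Y t) \<le> e / (s + 1) * t"
        unfolding X_def Y_def dist_norm using elim norm_integral_diff_le[OF Vc Wc t, of n "e / (s + 1)"]
        by (simp add: dist_norm less_imp_le)
      also have "\<dots> \<le> e / (s + 1) * s" using t e s by (intro mult_left_mono) auto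
      also have "\<dots> < e" using e s by (simp add: field_simps)
      finally show ?case .
    qed
  qed
  \<comment> \<open>\<open>V (Suc n) t\<close> is admissible at \<open>X n t\<close>, hence at
    vanishing distance from \<open>F (Y t)\<close>, which is closed.\<close>
  have WF: "W t \<in> F (Y t)" if t: "t \<in> {0..s}" for t
  proof -
    have "\<forall>n. \<exists>w. w \<in> F (Y t) \<and> norm (V (Suc n) t - w) \<le> L * norm (X n t - Y t)"
      using L(2)[OF XK[OF t] YK[OF t] VF] unfolding Bex_def by (rule allI)
    from choice[OF this] obtain w where w': "\<forall>n. w n \<in> F (Y t) \<and>
      norm (V (Suc n) t - w n) \<le> L * norm (X n t - Y t)" by (rule exE)
    then have w: "w n \<in> F (Y t)" "norm (V (Suc n) t - w n) \<le> L * norm (X n t - Y t)" for n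
      by simp_all
    have "(\<lambda>n. L * norm (X n t - Y t)) \<longlonglongrightarrow> L * norm (Y t - Y t)"
      by (intro tendsto_intros XY t)
    then have "(\<lambda>n. L * norm (X n t - Y t)) \<longlonglongrightarrow> 0" by simp
    then have "(\<lambda>n. V (Suc n) t - w n) \<longlonglongrightarrow> 0"
      by (rule Lim_null_comparison[rotated]) (simp add: w(2))
    then have "(\<lambda>n. V (Suc n) t - (V (Suc n) t - w n)) \<longlonglongrightarrow> W t - 0"
      by (intro tendsto_diff LIMSEQ_Suc VW t)
    then have "w \<longlonglongrightarrow> W t" by simp
    then show ?thesis by (rule closed_sequentially[OF F'(2) w(1)])
  qed
  have Yd: "(Y has_vector_derivative W t) (at t within {0..s})" if "t \<in> {0..s}" for t
    unfolding Y_def using integral_has_vector_derivative[OF Wc that] by (auto intro!: derivative_eq_intros)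
  have WB: "norm (W t) \<le> norm v + 2 * A" if "t \<in> {0..s}" for t
    using W2[OF that] norm_triangle_ineq[of "W t - v" v] by simp
  have "(norm v + 2 * A)-lipschitz_on {0..s} Y"
  proof (rule bounded_derivative_imp_lipschitz)
    show "(Y has_derivative (\<lambda>h. h *\<^sub>R W t)) (at t within {0..s})" if "t \<in> {0..s}" for t
      using Yd[OF that] by (simp add: has_vector_derivative_def)
    show "onorm (\<lambda>h. h *\<^sub>R W t) \<le> norm v + 2 * A" if "t \<in> {0..s}" for t
      by (rule onorm_le) (use WB[OF that] in \<open>auto simp: mult.commute intro: mult_left_mono\<close>)
  qed (use A0 in auto)
  then have "trajectory_on F {0..s} Y"
    using Yd WF by (intro trajectory_on_lipschitzI[where N = "{}"]) auto
  moreover have "Y 0 = x" by (simp add: Y_def)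
  ultimately have "reaches F s x (Y s)" unfolding reaches_def using s by blast
  moreover have "norm (Y s - x - s *\<^sub>R v) \<le> 2 * A * s"
    using norm_integral_diff_le[OF Wc continuous_on_const _ W2, of s] s by (simp add: Y_def)
  ultimately show ?thesis by blast
qed

text \<open>Makes the construction uniform over starting points near \<open>\<alpha>\<close>. The
  deviation from the straight motion with velocity \<open>v\<close> is of second order in the
  distance and the time.\<close>

lemma exists_local_reaches:
  fixes v \<alpha> :: "real ^ 'n::finite"
  assumes F: "compact_convex_valued F" "locally_Lipschitz F" and v: "v \<in> F \<alpha>"
  obtains \<delta> C where "\<delta> > 0" "C \<ge> 0"
    "\<And>x s. norm (x - \<alpha>) \<le> \<delta> \<Longrightarrow> 0 \<le> s \<Longrightarrow> s \<le> \<delta> \<Longrightarrow>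
      \<exists>z. reaches F s x z \<and> norm (z - x - s *\<^sub>R v) \<le> C * s * (norm (x - \<alpha>) + s)"
proof -
  obtain L where L: "L \<ge> 0" "\<And>x y v. x \<in> cball \<alpha> 1 \<Longrightarrow> y \<in> cball \<alpha> 1 \<Longrightarrow> v \<in> F x \<Longrightarrow>
      \<exists>w\<in>F y. norm (v - w) \<le> L * norm (x - y)"
    using locally_LipschitzE[OF F(2) compact_cball] by blast
  define m where "m = 1 + norm v"
  \<comment> \<open>Chosen so that \<open>2 * (m * \<delta>) + 2 * (L * (m * \<delta>)) = 1\<close>.
    This gives both the contraction condition \<open>L * s \<le> 1/2\<close> and room to stay in the
    unit ball.\<close>
  define \<delta> where "\<delta> = 1 / (2 * m * (1 + L))"
  have m: "m \<ge> 1" by (simp add: m_def)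
  have \<delta>: "\<delta> > 0" using m L by (simp add: \<delta>_def)
  have "2 * m * (1 + L) * \<delta> = 1" using m L by (simp add: \<delta>_def)
  then have e: "2 * (m * \<delta>) + 2 * (L * (m * \<delta>)) = 1" by (simp add: algebra_simps)
  have L0: "0 \<le> L * (m * \<delta>)" using L m \<delta> by simp
  have m\<delta>: "\<delta> \<le> m * \<delta>" using m \<delta> by simp
  have L\<delta>: "L * \<delta> \<le> 1/2" using mult_left_mono[OF m\<delta> L(1)] e L0 m \<delta> mult_pos_pos[of m \<delta>] by linarith
  show ?thesis
  proof (rule that[of \<delta> "2 * L * m"])
    fix x s assume xs: "norm (x - \<alpha>) \<le> \<delta>" "0 \<le> s" "s \<le> \<delta>"
    define A where "A = L * (norm (x - \<alpha>) + s * norm v)"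
    have s1: "L * s \<le> 1/2" using mult_left_mono[OF xs(3) L(1)] L\<delta> by linarith
    have sv: "s * norm v \<le> \<delta> * norm v" using xs by (intro mult_right_mono) auto
    have A1: "A \<le> L * (m * \<delta>)" unfolding A_def m_def
      using L xs sv by (intro mult_left_mono) (auto simp: algebra_simps)
    have "norm (x - \<alpha>) + s * (norm v + 2 * A) = norm (x - \<alpha>) + s * norm v + 2 * (s * A)"
      by (simp add: algebra_simps)
    also have "s * A \<le> \<delta> * (L * (m * \<delta>))"
      using xs A1 \<delta> L by (intro mult_mono) (auto simp: A_def)
    also have "\<dots> = (L * \<delta>) * (m * \<delta>)" by simp
    also have "\<dots> \<le> 1/2 * (m * \<delta>)" using L\<delta> m \<delta> by (intro mult_right_mono) auto
    also have "norm (x - \<alpha>) + s * norm v + 2 * (1/2 * (m * \<delta>)) \<le> 2 * (m * \<delta>)"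
      using xs sv by (simp add: m_def algebra_simps)
    also have "\<dots> \<le> 1" using e L0 by linarith
    finally have stay: "norm (x - \<alpha>) + s * (norm v + 2 * A) \<le> 1" by simp
    obtain z where z: "reaches F s x z" "norm (z - x - s *\<^sub>R v) \<le> 2 * A * s"
      using filippov_reaches[OF F(1) v L xs(2) s1 A_def stay] by blast
    have "norm (x - \<alpha>) + s * norm v \<le> m * (norm (x - \<alpha>) + s)"
      using xs by (simp add: m_def algebra_simps)
    then have "A \<le> L * (m * (norm (x - \<alpha>) + s))" unfolding A_def by (rule mult_left_mono) fact
    then have "2 * s * A \<le> 2 * s * (L * (m * (norm (x - \<alpha>) + s)))"
      using xs by (intro mult_left_mono) auto
    with z show "\<exists>z. reaches F s x z \<and> norm (z - x - s *\<^sub>R v) \<le> 2 * L * m * s * (norm (x - \<alpha>) + s)"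
      by (intro exI[of _ z]) (simp add: algebra_simps)
  qed (use \<delta> L m in auto)
qed

section \<open>Hamiltonian bounds along trajectories\<close>

text \<open>A \<open>LEAST\<close> over the reals is meaningful only if the minimum is attained,
  which compactness of \<open>F x\<close> ensures.\<close>

lemma hamiltonian_attained:
  assumes "compact_convex_valued F"
  shows "\<exists>v\<in>F x. v \<bullet> p = hamiltonian F x p \<and> (\<forall>w\<in>F x. v \<bullet> p \<le> w \<bullet> p)"
proof -
  have "compact (F x)" "F x \<noteq> {}" using assms unfolding compact_convex_valued_def by auto
  moreover have "continuous_on (F x) (\<lambda>w. w \<bullet> p)" by (intro continuous_intros)
  ultimately obtain v where v: "v \<in> F x" "\<forall>w\<in>F x. v \<bullet> p \<le> w \<bullet> p"
    using continuous_attains_inf by blast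
  have "hamiltonian F x p = v \<bullet> p"
    unfolding hamiltonian_def by (rule Least_equality) (use v in auto)
  then show ?thesis using v by auto
qed

lemma hamiltonian_le:
  assumes "compact_convex_valued F" "v \<in> F x"
  shows "hamiltonian F x p \<le> v \<bullet> p"
  using hamiltonian_attained[OF assms(1), of x p] assms(2) by auto

lemma hamiltonian_uminus: "hamiltonian (\<lambda>x. uminus ` F x) x p = hamiltonian F x (- p)"
  unfolding hamiltonian_def by simp

lemma compact_convex_valued_uminus:
  "compact_convex_valued F \<Longrightarrow> compact_convex_valued (\<lambda>x. uminus ` F x)"
  unfolding compact_convex_valued_def by (simp add: compact_negations convex_negations)

lemma locally_Lipschitz_uminus:
  assumes "locally_Lipschitz F"
  shows "locally_Lipschitz (\<lambda>x. uminus ` F x)"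
  unfolding locally_Lipschitz_def
proof (intro allI impI)
  fix K :: "(real ^ 'a) set" assume "compact K"
  with assms obtain L where L: "\<forall>x\<in>K. \<forall>y\<in>K.
      F x \<subseteq> {v + (L * norm (y - x)) *\<^sub>R b | v b. v \<in> F y \<and> b \<in> cball 0 1}"
    unfolding locally_Lipschitz_def by (elim allE[of _ K] impE exE)
  show "\<exists>L. \<forall>x\<in>K. \<forall>y\<in>K. uminus ` F x \<subseteq>
      {v + (L * norm (y - x)) *\<^sub>R b | v b. v \<in> uminus ` F y \<and> b \<in> cball 0 1}"
  proof (intro exI[of _ L] ballI subsetI)
    fix x y u assume *: "x \<in> K" "y \<in> K" "u \<in> uminus ` F x"
    then have "- u \<in> F x" by auto
    then have "- u \<in> {v + (L * norm (y - x)) *\<^sub>R b | v b. v \<in> F y \<and> b \<in> cball 0 1}"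
      by (rule subsetD[OF L[rule_format, OF *(1,2)]])
    then obtain v b where vb: "- u = v + (L * norm (y - x)) *\<^sub>R b" "v \<in> F y" "b \<in> cball 0 1"
      by auto
    then have "u = - v + (L * norm (y - x)) *\<^sub>R (- b)"
      by (metis add.inverse_inverse minus_add_distrib scaleR_minus_right)
    moreover have "- v \<in> uminus ` F y" "- b \<in> cball 0 1" using vb by auto
    ultimately show "u \<in> {v + (L * norm (y - x)) *\<^sub>R b | v b. v \<in> uminus ` F y \<and> b \<in> cball 0 1}"
      by (intro CollectI exI conjI)
  qed
qed

text \<open>The counterpart of the existence result: it holds for every short trajectory issued near
  \<open>\<alpha>\<close>. All velocities met on the way lie close to \<open>F \<alpha>\<close>, so
  their products with \<open>\<zeta>\<close> cannot fall far below the Hamiltonian at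
  \<open>\<alpha>\<close>.\<close>

lemma reaches_local_bounds:
  fixes \<alpha> :: "real ^ 'n::finite"
  assumes F: "compact_convex_valued F" "locally_Lipschitz F" "linear_growth F"
  obtains \<delta> C where "\<delta> > 0" "C \<ge> 0"
    "\<And>s x z \<zeta>. reaches F s x z \<Longrightarrow> s \<le> \<delta> \<Longrightarrow> norm (x - \<alpha>) \<le> \<delta> \<Longrightarrow>
      norm (z - x) \<le> C * s \<and>
      s * hamiltonian F \<alpha> \<zeta> - C * s * (norm (x - \<alpha>) + s) * norm \<zeta> \<le> \<zeta> \<bullet> (z - x)"
proof -
  obtain L where L: "L \<ge> 0" "\<And>x y v. x \<in> cball \<alpha> 1 \<Longrightarrow> y \<in> cball \<alpha> 1 \<Longrightarrow> v \<in> F x \<Longrightarrow>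
      \<exists>w\<in>F y. norm (v - w) \<le> L * norm (x - y)"
    using locally_LipschitzE[OF F(2) compact_cball] by blast
  obtain M where M: "M \<ge> 0" "\<And>x v. norm x \<le> norm \<alpha> + 1 \<Longrightarrow> v \<in> F x \<Longrightarrow> norm v \<le> M"
    using linear_growth_bounded[OF F(3)] by blast
  have M': "norm v \<le> M" if "norm (x - \<alpha>) \<le> 1" "v \<in> F x" for x v
    using M(2)[OF _ that(2)] that(1) norm_triangle_ineq[of "x - \<alpha>" \<alpha>] by simp
  \<comment> \<open>The start is within 1/2 of \<open>\<alpha>\<close> and the curve moves by less
    than 1/2, so it never leaves the unit ball.\<close>
  define \<delta> where "\<delta> = 1 / (2 * (M + 1))"
  have \<delta>: "\<delta> > 0" "\<delta> \<le> 1/2" "M * \<delta> < 1/2" using M(1) by (auto simp: \<delta>_def field_simps)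
  show ?thesis
  \<comment> \<open>One constant for both claims: \<open>M\<close> bounds the speed, and
    \<open>L * (1 + M)\<close> absorbs the velocity error
    \<open>L * (norm (x - \<alpha>) + M * s)\<close>.\<close>
  proof (rule that[of \<delta> "M + L * (1 + M)"])
    fix s x z and \<zeta> :: "real ^ 'n"
    assume r: "reaches F s x z" and s: "s \<le> \<delta>" and x: "norm (x - \<alpha>) \<le> \<delta>"
    obtain y where y: "trajectory_on F {0..s} y" "y 0 = x" "y s = z" and s0: "0 \<le> s"
      using r unfolding reaches_def by blast
    obtain N where N: "abs_continuous_on {0..s} y" "negligible N"
      "\<And>t. t \<in> {0..s} - N \<Longrightarrow> \<exists>v\<in>F (y t). (y has_vector_derivative v) (at t within {0..s})"
      using trajectory_onE[OF y(1)] by blast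
    have cont: "continuous_on {0..s} y" by (rule abs_continuous_on_imp_continuous_on[OF N(1)])
    \<comment> \<open>The ball condition is asked only before \<open>u\<close>, with
      \<open>u\<close> itself put into the null set, so that the estimate applies up to a first exit
      time.\<close>
    have inc: "norm (y u - x) \<le> M * u"
      if u: "u \<in> {0..s}" and b: "\<And>t. 0 \<le> t \<Longrightarrow> t < u \<Longrightarrow> norm (y t - \<alpha>) \<le> 1" for u
    proof -
      have sub: "{0..u} \<subseteq> {0..s}" using u by auto
      have "norm (y u - y 0) \<le> M * (u - 0)"
      proof (rule abs_continuous_norm_increment_le[where N = "insert u N"])
        show "abs_continuous_on {0..u} y" by (rule abs_continuous_on_subset[OF N(1) sub])
        fix t assume t: "t \<in> {0..u} - insert u N"
        then obtain v where v: "v \<in> F (y t)" "(y has_vector_derivative v) (at t within {0..s})"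
          using N(3)[of t] u by auto
        have "norm v \<le> M" by (rule M'[OF b v(1)]) (use t in auto)
        then show "\<exists>v. norm v \<le> M \<and> (y has_vector_derivative v) (at t within {0..u})"
          using has_vector_derivative_within_subset[OF v(2) sub] by blast
      qed (use u N in auto)
      then show ?thesis using y by simp
    qed
    \<comment> \<open>First exit argument: the earliest time \<open>u\<close> at distance at least 1
      exists by compactness, yet \<open>inc\<close> puts \<open>y u\<close> at distance less than
      1.\<close>
    have stay: "norm (y t - \<alpha>) < 1" if t: "t \<in> {0..s}" for t
    proof (rule ccontr)
      assume "\<not> norm (y t - \<alpha>) < 1"
      define E where "E = {u \<in> {0..s}. 1 \<le> norm (y u - \<alpha>)}"
      have "closed E" unfolding E_def
        by (rule continuous_on_closed_Collect_le) (use cont in \<open>auto intro!: continuous_intros\<close>)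
      moreover have "E \<subseteq> {0..s}" by (auto simp: E_def)
      ultimately have "compact E" using compact_Int_closed[of "{0..s}" E] by (simp add: Int_absorb1)
      moreover have "E \<noteq> {}" using t \<open>\<not> norm (y t - \<alpha>) < 1\<close> by (auto simp: E_def)
      ultimately obtain u where u: "u \<in> E" "\<forall>w\<in>E. u \<le> w" using compact_attains_inf by blast
      have us: "u \<in> {0..s}" "1 \<le> norm (y u - \<alpha>)" using u by (auto simp: E_def)
      have "norm (y u - x) \<le> M * u"
      proof (rule inc[OF us(1)])
        fix w assume "0 \<le> w" "w < u"
        then have "w \<notin> E" "w \<in> {0..s}" using u us by auto
        then show "norm (y w - \<alpha>) \<le> 1" by (auto simp: E_def)
      qed
      also have "\<dots> \<le> M * \<delta>" using us s M(1) by (intro mult_left_mono) auto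
      also have "\<dots> < 1/2" by (rule \<delta>)
      finally have "norm (y u - x) < 1/2" .
      then show False using us(2) x \<delta>(2) norm_triangle_ineq[of "y u - x" "x - \<alpha>"] by simp
    qed
    have Mu: "norm (y u - x) \<le> M * u" if "u \<in> {0..s}" for u
      by (rule inc[OF that]) (use stay that in \<open>auto intro: less_imp_le\<close>)
    \<comment> \<open>A lower bound for the product of \<open>\<zeta>\<close> with the velocities
      along the curve; the mean value inequality, which bounds from above, is therefore applied to
      \<open>- \<zeta>\<close>.\<close>
    define m where "m = hamiltonian F \<alpha> \<zeta> - norm \<zeta> * (L * (norm (x - \<alpha>) + M * s))"
    have "(- \<zeta>) \<bullet> (y s - y 0) \<le> (- m) * (s - 0)"
    proof (rule abs_continuous_inner_increment_le[OF N(1) s0 N(2)])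
      fix t assume t: "t \<in> {0..s} - N"
      then obtain v where v: "v \<in> F (y t)" "(y has_vector_derivative v) (at t within {0..s})"
        using N(3) by blast
      obtain w where w: "w \<in> F \<alpha>" "norm (v - w) \<le> L * norm (y t - \<alpha>)"
        using L(2)[of "y t" \<alpha> v] v stay[of t] t by (auto simp: dist_norm norm_minus_commute)
      have "norm (y t - \<alpha>) \<le> norm (x - \<alpha>) + M * t"
        using Mu[of t] t norm_triangle_ineq[of "y t - x" "x - \<alpha>"] by simp
      also have "\<dots> \<le> norm (x - \<alpha>) + M * s" using t M(1) by (auto intro: mult_left_mono)
      finally have "L * norm (y t - \<alpha>) \<le> L * (norm (x - \<alpha>) + M * s)" using L(1) by (rule mult_left_mono)
      then have "norm \<zeta> * norm (v - w) \<le> norm \<zeta> * (L * (norm (x - \<alpha>) + M * s))"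
        using w(2) by (intro mult_left_mono) auto
      moreover have "- (\<zeta> \<bullet> (v - w)) \<le> norm \<zeta> * norm (v - w)"
        using norm_cauchy_schwarz[of "- \<zeta>" "v - w"] by simp
      moreover have "hamiltonian F \<alpha> \<zeta> \<le> \<zeta> \<bullet> w"
        using hamiltonian_le[OF F(1) w(1), of \<zeta>] by (simp add: inner_commute)
      ultimately have "(- \<zeta>) \<bullet> v \<le> - m" by (simp add: m_def inner_diff_right)
      then show "\<exists>v. (- \<zeta>) \<bullet> v \<le> - m \<and> (y has_vector_derivative v) (at t within {0..s})"
        using v(2) by blast
    qed
    then have ms: "m * s \<le> \<zeta> \<bullet> (z - x)" using y by simp
    define \<rho> where "\<rho> = norm (x - \<alpha>)"
    have \<rho>: "\<rho> \<ge> 0" by (simp add: \<rho>_def)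
    have "L * (\<rho> + M * s) \<le> (M + L * (1 + M)) * (\<rho> + s)"
      using \<rho> s0 M(1) L(1) by (simp add: algebra_simps)
    then have "(norm \<zeta> * s) * (L * (\<rho> + M * s)) \<le> (norm \<zeta> * s) * ((M + L * (1 + M)) * (\<rho> + s))"
      using s0 by (intro mult_left_mono) auto
    then have "s * hamiltonian F \<alpha> \<zeta> - (M + L * (1 + M)) * s * (\<rho> + s) * norm \<zeta> \<le> m * s"
      unfolding m_def \<rho>_def[symmetric] by (simp add: algebra_simps)
    moreover have "norm (z - x) \<le> (M + L * (1 + M)) * s"
    proof -
      have "M * s \<le> (M + L * (1 + M)) * s" using s0 L M by (intro mult_right_mono) auto
      then show ?thesis using Mu[of s] s0 y by simp
    qed
    ultimately show "norm (z - x) \<le> (M + L * (1 + M)) * s \<and>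
      s * hamiltonian F \<alpha> \<zeta> - (M + L * (1 + M)) * s * (norm (x - \<alpha>) + s) * norm \<zeta> \<le> \<zeta> \<bullet> (z - x)"
      using ms unfolding \<rho>_def by linarith
  qed (use \<delta> L M in auto)
qed

text \<open>A trajectory of \<open>-F\<close> leaving with velocity \<open>- v\<close> becomes,
  after reversal, a trajectory of \<open>F\<close> arriving with velocity near
  \<open>v\<close>.\<close>

lemma exists_local_reaches_backward:
  fixes v \<alpha> :: "real ^ 'n::finite"
  assumes F: "compact_convex_valued F" "locally_Lipschitz F" "linear_growth F" and v: "v \<in> F \<alpha>"
  obtains \<delta> C where "\<delta> > 0" "C \<ge> 0"
    "\<And>x s. norm (x - \<alpha>) \<le> \<delta> \<Longrightarrow> 0 \<le> s \<Longrightarrow> s \<le> \<delta> \<Longrightarrow>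
      \<exists>z. reaches F s z x \<and> norm (z - x + s *\<^sub>R v) \<le> C * s * (norm (x - \<alpha>) + s)"
proof -
  have "- v \<in> uminus ` F \<alpha>" using v by simp
  show ?thesis
  proof (rule exists_local_reaches[OF compact_convex_valued_uminus[OF F(1)]
        locally_Lipschitz_uminus[OF F(2)] \<open>- v \<in> uminus ` F \<alpha>\<close>])
    fix \<delta> C :: real
    assume "\<delta> > 0" "C \<ge> 0" and *: "\<And>x s. norm (x - \<alpha>) \<le> \<delta> \<Longrightarrow> 0 \<le> s \<Longrightarrow> s \<le> \<delta> \<Longrightarrow>
      \<exists>z. reaches (\<lambda>x. uminus ` F x) s x z \<and>
        norm (z - x - s *\<^sub>R - v) \<le> C * s * (norm (x - \<alpha>) + s)"
    show thesis
      by (rule that[OF \<open>\<delta> > 0\<close> \<open>C \<ge> 0\<close>]) (use * in \<open>simp add: reaches_uminus_iff[OF F(3)]\<close>)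
  qed
qed

section \<open>Dynamic programming inequality and subgradients in epsilon-delta form\<close>

lemma min_time_reaches_le:
  assumes "linear_growth F" "reaches F s z x" "min_time F x y \<le> ereal t"
  shows "min_time F z y \<le> ereal (s + t)"
\<comment> \<open>The infimum need not be attained, so a connection from \<open>x\<close> to
  \<open>y\<close> is available only up to a slack \<open>e\<close>.\<close>
proof (rule ereal_le_epsilon2)
  fix e :: real assume "e > 0"
  then have "min_time F x y < ereal (t + e)" using assms(3) by (simp add: order.strict_trans1)
  then obtain \<tau> where \<tau>: "\<tau> < t + e" "reaches F \<tau> x y" by (rule min_time_less_imp_reaches)
  have "min_time F z y \<le> ereal (s + \<tau>)"
    by (rule min_time_le[OF reaches_trans[OF assms(1,2) \<tau>(2)]])
  also have "\<dots> \<le> ereal (s + t) + ereal e" using \<tau>(1) by simp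
  finally show "min_time F z y \<le> ereal (s + t) + ereal e" .
qed

text \<open>In both Hamiltonian bounds below, all errors are collected into one multiple of
  \<open>\<epsilon>\<close>, which this limit removes.\<close>

lemma le_if_le_add_small:
  fixes a b K :: real
  assumes "\<And>\<epsilon>. 0 < \<epsilon> \<Longrightarrow> \<epsilon> \<le> 1 \<Longrightarrow> a \<le> b + \<epsilon> * K"
  shows "a \<le> b"
proof -
  have "((\<lambda>\<epsilon>. b + \<epsilon> * K) \<longlongrightarrow> b + 0 * K) (at_right 0)" by (intro tendsto_intros)
  moreover have "\<forall>\<^sub>F \<epsilon> in at_right 0. a \<le> b + \<epsilon> * K"
    using assms by (auto simp: eventually_at intro!: exI[of _ 1])
  ultimately have "a \<le> b + 0 * K" by (rule tendsto_lowerbound) simp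
  then show ?thesis by simp
qed

text \<open>With \<open>f x\<close> finite and \<open>- \<infinity>\<close> excluded, the
  denominator of the difference quotient can be cleared, also where \<open>f\<close> is
  infinite.\<close>

lemma frechet_subdifferential_iff:
  fixes f :: "'a::euclidean_space \<Rightarrow> ereal"
  assumes fx: "f x = ereal r" and f0: "\<And>y. f y \<noteq> - \<infinity>"
  shows "\<zeta> \<in> frechet_subdifferential f x \<longleftrightarrow>
    (\<forall>\<epsilon>>0. \<exists>\<delta>>0. \<forall>y. norm (y - x) < \<delta> \<longrightarrow> ereal (r + \<zeta> \<bullet> (y - x) - \<epsilon> * norm (y - x)) \<le> f y)"
    (is "_ \<longleftrightarrow> ?R")
proof -
  define q where "q y = (f y - f x - ereal (\<zeta> \<bullet> (y - x))) / ereal (norm (y - x))" for y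
  have q: "ereal c \<le> q y \<longleftrightarrow> ereal (r + \<zeta> \<bullet> (y - x) + c * norm (y - x)) \<le> f y"
    if "y \<noteq> x" for y c
  proof (cases "f y")
    case (real t)
    then show ?thesis using that unfolding q_def fx by (simp add: field_simps)
  next
    case PInf
    then show ?thesis using that unfolding q_def fx by simp
  qed (use f0 in auto)
  have "\<zeta> \<in> frechet_subdifferential f x \<longleftrightarrow> (\<forall>c<0. \<forall>\<^sub>F y in at x. c < q y)"
    unfolding frechet_subdifferential_def q_def by (simp add: le_Liminf_iff)
  \<comment> \<open>The levels \<open>c\<close> range over negative extended reals; a real strictly
    between \<open>c\<close> and 0 reduces them to the form \<open>- \<epsilon>\<close> and yields
    the strict inequality.\<close>
  also have "\<dots> \<longleftrightarrow> (\<forall>\<epsilon>>0. \<forall>\<^sub>F y in at x. ereal (- \<epsilon>) \<le> q y)"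
  proof safe
    fix \<epsilon> :: real assume "\<forall>c<0. \<forall>\<^sub>F y in at x. c < q y" "\<epsilon> > 0"
    then have "\<forall>\<^sub>F y in at x. ereal (- \<epsilon>) < q y" by simp
    then show "\<forall>\<^sub>F y in at x. ereal (- \<epsilon>) \<le> q y" by (rule eventually_mono) auto
  next
    fix c :: ereal assume *: "\<forall>\<epsilon>>0. \<forall>\<^sub>F y in at x. ereal (- \<epsilon>) \<le> q y" and "c < 0"
    then obtain d where d: "c < ereal d" "ereal d < 0" using ereal_dense2 by blast
    then have "\<forall>\<^sub>F y in at x. ereal (- (- d)) \<le> q y" using *[rule_format, of "- d"] by simp
    then show "\<forall>\<^sub>F y in at x. c < q y" by (rule eventually_mono) (use d in auto)
  qed
  also have "\<dots> \<longleftrightarrow> ?R"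
  proof (intro all_cong1 imp_cong refl)
    fix \<epsilon> :: real assume "\<epsilon> > 0"
    \<comment> \<open>At \<open>y = x\<close> the cleared inequality reads
      \<open>ereal r \<le> f x\<close>, which holds, so punctured and full neighbourhoods
      agree.\<close>
    have "(\<forall>y. norm (y - x) < \<delta> \<longrightarrow> ereal (r + \<zeta> \<bullet> (y - x) - \<epsilon> * norm (y - x)) \<le> f y) \<longleftrightarrow>
        (\<forall>y. y \<noteq> x \<and> dist y x < \<delta> \<longrightarrow> ereal (- \<epsilon>) \<le> q y)" for \<delta>
    proof (intro all_cong1)
      fix y show "(norm (y - x) < \<delta> \<longrightarrow> ereal (r + \<zeta> \<bullet> (y - x) - \<epsilon> * norm (y - x)) \<le> f y) \<longleftrightarrow>
        (y \<noteq> x \<and> dist y x < \<delta> \<longrightarrow> ereal (- \<epsilon>) \<le> q y)"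
        using q[of y "- \<epsilon>"] by (cases "y = x") (auto simp: fx dist_norm)
    qed
    then show "(\<forall>\<^sub>F y in at x. ereal (- \<epsilon>) \<le> q y) \<longleftrightarrow>
       (\<exists>\<delta>>0. \<forall>y. norm (y - x) < \<delta> \<longrightarrow> ereal (r + \<zeta> \<bullet> (y - x) - \<epsilon> * norm (y - x)) \<le> f y)"
      by (simp add: eventually_at)
  qed
  finally show ?thesis .
qed

section \<open>Subgradients of the minimal time\<close>

text \<open>Let \<open>v\<close> minimize the product with \<open>\<zeta>\<close>. Some
  \<open>z\<close> near \<open>\<alpha> - s *\<^sub>R v\<close> reaches \<open>\<alpha>\<close> in
  time \<open>s\<close>, so its minimal time to \<open>\<beta>\<close> is at most
  \<open>s + r\<close>. The subgradient inequality at \<open>z\<close> then compares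
  \<open>- s * hamiltonian F \<alpha> \<zeta>\<close> with \<open>s\<close> up to smaller
  terms.\<close>

lemma hamiltonian_subgradient_ge:
  fixes \<alpha> \<beta> \<zeta> :: "real ^ 'n::finite"
  assumes F: "compact_convex_valued F" "locally_Lipschitz F" "linear_growth F"
    and T: "min_time F \<alpha> \<beta> = ereal r"
    and sub: "\<And>\<epsilon>. \<epsilon> > 0 \<Longrightarrow> \<exists>\<delta>>0. \<forall>x. norm (x - \<alpha>) < \<delta> \<longrightarrow>
      ereal (r + \<zeta> \<bullet> (x - \<alpha>) - \<epsilon> * norm (x - \<alpha>)) \<le> min_time F x \<beta>"
  shows "hamiltonian F \<alpha> \<zeta> \<ge> -1"
proof -
  obtain v where v: "v \<in> F \<alpha>" "v \<bullet> \<zeta> = hamiltonian F \<alpha> \<zeta>"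
    using hamiltonian_attained[OF F(1)] by blast
  obtain d C where d: "d > 0" and C: "C \<ge> 0" and bwd:
    "\<And>x s. norm (x - \<alpha>) \<le> d \<Longrightarrow> 0 \<le> s \<Longrightarrow> s \<le> d \<Longrightarrow>
      \<exists>z. reaches F s z x \<and> norm (z - x + s *\<^sub>R v) \<le> C * s * (norm (x - \<alpha>) + s)"
    using exists_local_reaches_backward[OF F v(1)] by blast
  have "- hamiltonian F \<alpha> \<zeta> \<le> 1"
  proof (rule le_if_le_add_small)
    fix \<epsilon> :: real assume \<epsilon>: "0 < \<epsilon>" "\<epsilon> \<le> 1"
    obtain \<delta> where \<delta>: "\<delta> > 0" "\<And>x. norm (x - \<alpha>) < \<delta> \<Longrightarrow>
        ereal (r + \<zeta> \<bullet> (x - \<alpha>) - \<epsilon> * norm (x - \<alpha>)) \<le> min_time F x \<beta>"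
      using sub[OF \<epsilon>(1)] by blast
    \<comment> \<open>A speed bound: \<open>norm (z - \<alpha>) \<le> s * B\<close>, which keeps
      \<open>z\<close> within \<open>\<delta>\<close>. Below, \<open>s \<le> \<epsilon>\<close>
      turns terms quadratic in \<open>s\<close> into multiples of
      \<open>s * \<epsilon>\<close>.\<close>
    define B where "B = norm v + C + 1"
    have B: "B > 0" unfolding B_def using C by (simp add: add_nonneg_pos)
    define s where "s = min \<epsilon> (min d (\<delta> / (2 * B)))"
    have s: "0 < s" "s \<le> \<epsilon>" "s \<le> d" "s \<le> 1" using \<epsilon> d \<delta> B by (auto simp: s_def)
    have "s \<le> \<delta> / (2 * B)" by (simp add: s_def)
    then have sB: "s * B < \<delta>" using B \<delta>(1) by (simp add: field_simps)
    obtain z where z: "reaches F s z \<alpha>" "norm (z - \<alpha> + s *\<^sub>R v) \<le> C * s * s"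
      using bwd[of \<alpha> s] s d by auto
    have Cs: "C * s * s \<le> C * s" using s C by (simp add: mult_left_le)
    have nz: "norm (z - \<alpha>) \<le> s * B"
    proof -
      have "norm (z - \<alpha>) \<le> norm (z - \<alpha> + s *\<^sub>R v) + norm (s *\<^sub>R v)"
        using norm_triangle_ineq4[of "z - \<alpha> + s *\<^sub>R v" "s *\<^sub>R v"] by simp
      also have "\<dots> \<le> C * s + s * norm v" using z(2) Cs s by simp
      also have "\<dots> \<le> s * B" using s by (simp add: B_def algebra_simps)
      finally show ?thesis .
    qed
    have "ereal (r + \<zeta> \<bullet> (z - \<alpha>) - \<epsilon> * norm (z - \<alpha>)) \<le> min_time F z \<beta>"
      using nz sB by (intro \<delta>(2)) simp
    also have "\<dots> \<le> ereal (s + r)" by (rule min_time_reaches_le[OF F(3) z(1)]) (simp add: T)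
    finally have 1: "\<zeta> \<bullet> (z - \<alpha>) - \<epsilon> * norm (z - \<alpha>) \<le> s" by simp
    have "\<zeta> \<bullet> (z - \<alpha>) = \<zeta> \<bullet> (z - \<alpha> + s *\<^sub>R v) - s * hamiltonian F \<alpha> \<zeta>"
      using v(2) by (simp add: inner_add_right inner_commute)
    moreover have "- (\<zeta> \<bullet> (z - \<alpha> + s *\<^sub>R v)) \<le> norm \<zeta> * (C * s * s)"
    proof -
      have "- (\<zeta> \<bullet> (z - \<alpha> + s *\<^sub>R v)) \<le> norm \<zeta> * norm (z - \<alpha> + s *\<^sub>R v)"
        using norm_cauchy_schwarz[of "- \<zeta>" "z - \<alpha> + s *\<^sub>R v"] by simp
      also have "\<dots> \<le> norm \<zeta> * (C * s * s)" using z(2) by (intro mult_left_mono) auto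
      finally show ?thesis .
    qed
    moreover have "norm \<zeta> * (C * s * s) \<le> norm \<zeta> * (C * s * \<epsilon>)"
      using s C by (intro mult_left_mono) auto
    moreover have "\<epsilon> * norm (z - \<alpha>) \<le> \<epsilon> * (s * B)" using nz \<epsilon> by (intro mult_left_mono) auto
    ultimately have "s * (- hamiltonian F \<alpha> \<zeta>) \<le> s + norm \<zeta> * (C * s * \<epsilon>) + \<epsilon> * (s * B)"
      using 1 by linarith
    also have "\<dots> = s * (1 + \<epsilon> * (norm \<zeta> * C + B))" by (simp add: algebra_simps)
    finally show "- hamiltonian F \<alpha> \<zeta> \<le> 1 + \<epsilon> * (norm \<zeta> * C + B)" using s(1) by (simp only: mult_le_cancel_left_pos)
  qed
  then show ?thesis by simp
qed

text \<open>After time \<open>s\<close> on a nearly optimal trajectory the remaining time is at most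
  \<open>\<tau> - s\<close>. The subgradient inequality bounds the change of \<open>\<zeta>\<close>
  by about \<open>- s\<close> from above, while the local bound gives about
  \<open>s * hamiltonian F \<alpha> \<zeta>\<close> from below.\<close>

lemma hamiltonian_subgradient_le:
  fixes \<alpha> \<beta> \<zeta> :: "real ^ 'n::finite"
  assumes F: "compact_convex_valued F" "locally_Lipschitz F" "linear_growth F"
    and T: "min_time F \<alpha> \<beta> = ereal r" and r: "0 < r"
    and sub: "\<And>\<epsilon>. \<epsilon> > 0 \<Longrightarrow> \<exists>\<delta>>0. \<forall>x. norm (x - \<alpha>) < \<delta> \<longrightarrow>
      ereal (r + \<zeta> \<bullet> (x - \<alpha>) - \<epsilon> * norm (x - \<alpha>)) \<le> min_time F x \<beta>"
  shows "hamiltonian F \<alpha> \<zeta> \<le> -1"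
proof -
  obtain d C where d: "d > 0" and C: "C \<ge> 0" and fwd:
    "\<And>s x z \<zeta>. reaches F s x z \<Longrightarrow> s \<le> d \<Longrightarrow> norm (x - \<alpha>) \<le> d \<Longrightarrow>
      norm (z - x) \<le> C * s \<and>
      s * hamiltonian F \<alpha> \<zeta> - C * s * (norm (x - \<alpha>) + s) * norm \<zeta> \<le> \<zeta> \<bullet> (z - x)"
    using reaches_local_bounds[OF F, where \<alpha> = \<alpha>] by blast
  show ?thesis
  proof (rule le_if_le_add_small)
    fix \<epsilon> :: real assume \<epsilon>: "0 < \<epsilon>" "\<epsilon> \<le> 1"
    obtain \<delta> where \<delta>: "\<delta> > 0" "\<And>x. norm (x - \<alpha>) < \<delta> \<Longrightarrow>
        ereal (r + \<zeta> \<bullet> (x - \<alpha>) - \<epsilon> * norm (x - \<alpha>)) \<le> min_time F x \<beta>"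
      using sub[OF \<epsilon>(1)] by blast
    define s where "s = min (min \<epsilon> r) (min d (\<delta> / (2 * (C + 1))))"
    have s: "0 < s" "s \<le> \<epsilon>" "s \<le> d" "s \<le> r" using \<epsilon> d \<delta> C r by (auto simp: s_def)
    have "s \<le> \<delta> / (2 * (C + 1))" by (simp add: s_def)
    then have "2 * (C * s) + 2 * s \<le> \<delta>" using C by (simp add: field_simps)
    then have sB: "C * s < \<delta>" using s(1) C mult_nonneg_nonneg[of C s] by linarith
    \<comment> \<open>The excess over the infimum must be small compared with \<open>s\<close>,
      hence the choice \<open>s * s\<close>.\<close>
    have "min_time F \<alpha> \<beta> < ereal (r + s * s)" using T s by simp
    then obtain \<tau> where \<tau>: "\<tau> < r + s * s" "reaches F \<tau> \<alpha> \<beta>" by (rule min_time_less_imp_reaches)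
    have "r \<le> \<tau>" using min_time_le[OF \<tau>(2)] T by simp
    then obtain z where z: "reaches F s \<alpha> z" "reaches F (\<tau> - s) z \<beta>"
      using reaches_split[OF F(3) \<tau>(2), of s] s by auto
    have nz: "norm (z - \<alpha>) \<le> C * s" and
      iz: "s * hamiltonian F \<alpha> \<zeta> - C * s * s * norm \<zeta> \<le> \<zeta> \<bullet> (z - \<alpha>)"
      using fwd[OF z(1) s(3), of \<zeta>] d by auto
    have "ereal (r + \<zeta> \<bullet> (z - \<alpha>) - \<epsilon> * norm (z - \<alpha>)) \<le> min_time F z \<beta>"
      using nz sB by (intro \<delta>(2)) simp
    also have "\<dots> \<le> ereal (\<tau> - s)" by (rule min_time_le[OF z(2)])
    finally have 1: "\<zeta> \<bullet> (z - \<alpha>) - \<epsilon> * norm (z - \<alpha>) \<le> s * s - s" using \<tau>(1) by simp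
    have "\<epsilon> * norm (z - \<alpha>) \<le> \<epsilon> * (C * s)" using nz \<epsilon> by (intro mult_left_mono) auto
    moreover have "C * s * s * norm \<zeta> \<le> C * s * \<epsilon> * norm \<zeta>"
      using s C by (intro mult_right_mono mult_left_mono) auto
    moreover have "s * s \<le> s * \<epsilon>" using s by simp
    ultimately have "s * hamiltonian F \<alpha> \<zeta> \<le> - s + s * \<epsilon> + C * s * \<epsilon> * norm \<zeta> + \<epsilon> * (C * s)"
      using 1 iz by linarith
    also have "\<dots> = s * (- 1 + \<epsilon> * (1 + C * norm \<zeta> + C))" by (simp add: algebra_simps)
    finally show "hamiltonian F \<alpha> \<zeta> \<le> - 1 + \<epsilon> * (1 + C * norm \<zeta> + C)"
      using s(1) by (simp only: mult_le_cancel_left_pos)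
  qed
qed

text \<open>Once \<open>x\<close> is shifted to \<open>z\<close> with \<open>(z, y)\<close> in
  \<open>reachable_pairs F r\<close>, the normal inequality bounds
  \<open>P + \<zeta> \<bullet> (z - x)\<close>. The value -1 of the Hamiltonian converts
  \<open>\<zeta> \<bullet> (z - x)\<close> into the time spent on the shift.\<close>

lemma normal_imp_subgradient:
  fixes \<alpha> \<beta> \<zeta> \<theta> :: "real ^ 'n::finite"
  assumes F: "compact_convex_valued F" "locally_Lipschitz F" "linear_growth F"
    and normal: "(\<zeta>, \<theta>) \<in> frechet_normal_cone (reachable_pairs F r) (\<alpha>, \<beta>)"
    and T: "min_time F \<alpha> \<beta> = ereal r"
    and ham: "hamiltonian F \<alpha> \<zeta> = -1" and \<epsilon>: "\<epsilon> > 0"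
  shows "\<exists>\<delta>>0. \<forall>p. norm (p - (\<alpha>, \<beta>)) < \<delta> \<longrightarrow>
    ereal (r + (\<zeta>, \<theta>) \<bullet> (p - (\<alpha>, \<beta>)) - \<epsilon> * norm (p - (\<alpha>, \<beta>))) \<le> min_time F (fst p) (snd p)"
proof -
  obtain v where v: "v \<in> F \<alpha>" "v \<bullet> \<zeta> = -1"
    using hamiltonian_attained[OF F(1), of \<alpha> \<zeta>] ham by auto
  obtain d1 C1 where d1: "d1 > 0" and C1: "C1 \<ge> 0" and fwd:
    "\<And>s x z \<zeta>. reaches F s x z \<Longrightarrow> s \<le> d1 \<Longrightarrow> norm (x - \<alpha>) \<le> d1 \<Longrightarrow>
      norm (z - x) \<le> C1 * s \<and>
      s * hamiltonian F \<alpha> \<zeta> - C1 * s * (norm (x - \<alpha>) + s) * norm \<zeta> \<le> \<zeta> \<bullet> (z - x)"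
    using reaches_local_bounds[OF F, where \<alpha> = \<alpha>] by blast
  obtain d2 C2 where d2: "d2 > 0" and C2: "C2 \<ge> 0" and bwd:
    "\<And>x s. norm (x - \<alpha>) \<le> d2 \<Longrightarrow> 0 \<le> s \<Longrightarrow> s \<le> d2 \<Longrightarrow>
      \<exists>z. reaches F s z x \<and> norm (z - x + s *\<^sub>R v) \<le> C2 * s * (norm (x - \<alpha>) + s)"
    using exists_local_reaches_backward[OF F v(1)] by blast
  define C where "C = max C1 C2"
  have C: "C \<ge> 0" "C1 \<le> C" "C2 \<le> C" using C1 by (auto simp: C_def)
  define n where "n = norm (\<zeta>, \<theta>)"
  \<comment> \<open>If the cut-off \<open>s = K * \<rho>\<close> is active, then
    \<open>P + s \<ge> 2 * \<rho>\<close> because \<open>\<bar>P\<bar> \<le> n * \<rho>\<close>;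
    this exceeds the allowed \<open>e * \<rho>\<close> unless \<open>\<rho> = 0\<close>.\<close>
  define K where "K = n + 2"
  \<comment> \<open>\<open>D * (\<rho> * \<rho>)\<close> bounds the second order errors for all
    times \<open>s \<le> K * \<rho>\<close>. \<open>Q\<close> is chosen so that the shifted pair
    stays within \<open>\<rho> * Q\<close> of \<open>(\<alpha>, \<beta>)\<close>, and
    \<open>R\<close> so that these errors cost at most \<open>e / 2 * \<rho>\<close>.\<close>
  define D where "D = C * K * (1 + K)"
  define Q where "Q = 1 + K * norm v + C * K + D"
  define R where "R = 1 + D * n"
  define e where "e = min \<epsilon> 1"
  have n: "n \<ge> 0" "norm \<zeta> \<le> n" unfolding n_def using norm_fst_le[of \<zeta> \<theta>] by auto
  have K: "K \<ge> 2" "n \<le> K" using n by (auto simp: K_def)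
  have D: "D \<ge> 0" using C K by (simp add: D_def)
  have Q: "Q \<ge> 1" unfolding Q_def using C K D by simp
  have R: "R \<ge> 1" using D n by (simp add: R_def)
  have e: "e > 0" "e \<le> \<epsilon>" "e \<le> 1" using \<epsilon> by (auto simp: e_def)
  obtain d3 where d3: "d3 > 0" "\<And>p. p \<in> reachable_pairs F r \<Longrightarrow> norm (p - (\<alpha>, \<beta>)) < d3 \<Longrightarrow>
      (\<zeta>, \<theta>) \<bullet> (p - (\<alpha>, \<beta>)) \<le> e / (2 * Q) * norm (p - (\<alpha>, \<beta>))"
  proof -
    have "e / (2 * Q) > 0" using e Q by simp
    then show ?thesis using normal that unfolding frechet_normal_cone_def by blast
  qed
  define \<delta> where "\<delta> = min (min 1 (e / (2 * R))) (min (d3 / Q) (min d1 d2 / K))"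
  show ?thesis
  proof (intro exI[of _ \<delta>] conjI allI impI)
    show "\<delta> > 0" unfolding \<delta>_def using e R Q d1 d2 d3 K by simp
    fix p :: "(real ^ 'n) \<times> (real ^ 'n)" assume p\<delta>: "norm (p - (\<alpha>, \<beta>)) < \<delta>"
    obtain x y where p: "p = (x, y)" by (cases p)
    define \<rho> where "\<rho> = norm (p - (\<alpha>, \<beta>))"
    define P where "P = (\<zeta>, \<theta>) \<bullet> (p - (\<alpha>, \<beta>))"
    have \<rho>0: "\<rho> \<ge> 0" by (simp add: \<rho>_def)
    have \<rho>1: "\<rho> \<le> 1" using p\<delta> by (simp add: \<delta>_def \<rho>_def)
    have "\<rho> \<le> e / (2 * R)" using p\<delta> by (simp add: \<delta>_def \<rho>_def)
    then have \<rho>R: "\<rho> * R \<le> e / 2" using R by (simp add: field_simps)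
    have "\<rho> < d3 / Q" using p\<delta> by (simp add: \<delta>_def \<rho>_def)
    then have \<rho>Q: "\<rho> * Q < d3" using Q by (simp add: field_simps)
    have "\<rho> \<le> min d1 d2 / K" using p\<delta> by (simp add: \<delta>_def \<rho>_def)
    then have \<rho>K: "K * \<rho> \<le> d1" "K * \<rho> \<le> d2" using K by (auto simp: field_simps)
    have "\<rho> \<le> K * \<rho>" using K \<rho>0 mult_right_mono[of 1 K \<rho>] by simp
    then have \<rho>d: "\<rho> \<le> d1" "\<rho> \<le> d2" using \<rho>K by auto
    have x\<rho>: "norm (x - \<alpha>) \<le> \<rho>" unfolding \<rho>_def p using norm_fst_le[of "x - \<alpha>" "y - \<beta>"] by simp
    have Pn: "\<bar>P\<bar> \<le> n * \<rho>" unfolding P_def n_def \<rho>_def by (rule Cauchy_Schwarz_ineq2)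
    have quad: "c * s * (norm (x - \<alpha>) + s) \<le> D * (\<rho> * \<rho>)"
      if "0 \<le> c" "c \<le> C" "0 \<le> s" "s \<le> K * \<rho>" for c s
    proof -
      have "c * s * (norm (x - \<alpha>) + s) \<le> C * (K * \<rho>) * (\<rho> + K * \<rho>)"
        using that x\<rho> C K \<rho>0 by (intro mult_mono add_mono) auto
      then show ?thesis by (simp add: D_def algebra_simps)
    qed
    have D\<rho>: "D * (\<rho> * \<rho>) \<le> D * \<rho>" using D \<rho>0 \<rho>1 by (intro mult_left_mono) (auto simp: mult_left_le)
    have shift: "P + \<zeta> \<bullet> (z - x) \<le> e / 2 * \<rho>"
      if z: "min_time F z y \<le> ereal r" and zx: "norm (z - x) \<le> (Q - 1) * \<rho>" for z
    proof -
      have eq: "(z, y) - (\<alpha>, \<beta>) = (p - (\<alpha>, \<beta>)) + (z - x, 0)" by (simp add: p)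
      have "norm ((z, y) - (\<alpha>, \<beta>)) \<le> \<rho> + norm (z - x)"
        unfolding eq \<rho>_def using norm_triangle_ineq[of "p - (\<alpha>, \<beta>)" "(z - x, 0)"] by (simp add: norm_Pair)
      also have "\<dots> \<le> \<rho> * Q" using zx by (simp add: algebra_simps)
      finally have nQ: "norm ((z, y) - (\<alpha>, \<beta>)) \<le> \<rho> * Q" .
      have "P + \<zeta> \<bullet> (z - x) = (\<zeta>, \<theta>) \<bullet> ((z, y) - (\<alpha>, \<beta>))"
        unfolding eq P_def by (simp add: inner_add_right)
      also have "\<dots> \<le> e / (2 * Q) * norm ((z, y) - (\<alpha>, \<beta>))"
        using z nQ \<rho>Q by (intro d3(2)) (auto simp: reachable_pairs_def)
      also have "\<dots> \<le> e / (2 * Q) * (\<rho> * Q)" using nQ e Q by (intro mult_left_mono) auto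
      also have "\<dots> = e / 2 * \<rho>" using Q by simp
      finally show ?thesis .
    qed
    have small: "n * (D * (\<rho> * \<rho>)) \<le> e / 2 * \<rho>"
    proof -
      have "n * (D * (\<rho> * \<rho>)) = (D * n) * \<rho> * \<rho>" by simp
      also have "\<dots> \<le> R * \<rho> * \<rho>" using \<rho>0 by (intro mult_right_mono) (auto simp: R_def)
      also have "\<dots> \<le> e / 2 * \<rho>" using \<rho>R \<rho>0 by (intro mult_right_mono) (auto simp: mult.commute)
      finally show ?thesis .
    qed
    have e\<rho>: "e * \<rho> \<le> \<epsilon> * \<rho>" using e \<rho>0 by (intro mult_right_mono) auto
    have main: "r + P - \<epsilon> * \<rho> \<le> \<tau>" if \<tau>: "reaches F \<tau> x y" for \<tau>
    proof (cases "r \<le> \<tau>")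
      case True
      define s where "s = \<tau> - r"
      show ?thesis
      \<comment> \<open>A larger excess needs no shift, since \<open>P \<le> n * \<rho>\<close> is
        then already below \<open>s\<close>.\<close>
      proof (cases "s \<le> n * \<rho>")
        case sn: True
        have sK: "s \<le> K * \<rho>" using sn K \<rho>0 mult_right_mono[OF K(2) \<rho>0] by linarith
        have s0: "0 \<le> s" using True by (simp add: s_def)
        have T0: "0 \<le> r" using T min_time_nonneg[of F \<alpha> \<beta>] by simp
        obtain z where z: "reaches F s x z" "reaches F (\<tau> - s) z y"
          using reaches_split[OF F(3) \<tau> s0] T0 by (auto simp: s_def)
        have b: "norm (z - x) \<le> C1 * s"
          "- s - C1 * s * (norm (x - \<alpha>) + s) * norm \<zeta> \<le> \<zeta> \<bullet> (z - x)"
          using fwd[OF z(1), of \<zeta>] sK \<rho>K \<rho>d x\<rho> ham by auto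
        have "C1 * s \<le> C * (K * \<rho>)" using C C1 sK s0 by (intro mult_mono) auto
        also have "\<dots> \<le> (Q - 1) * \<rho>"
          using \<rho>0 D K by (simp add: Q_def algebra_simps)
        finally have "P + \<zeta> \<bullet> (z - x) \<le> e / 2 * \<rho>"
          using b(1) min_time_le[OF z(2)] by (intro shift) (auto simp: s_def)
        moreover have "C1 * s * (norm (x - \<alpha>) + s) * norm \<zeta> \<le> D * (\<rho> * \<rho>) * n"
          by (rule mult_mono[OF quad[OF C1 C(2) s0 sK]]) (use n D \<rho>0 in auto)
        ultimately have "P \<le> e * \<rho> + s" using b(2) small by (simp add: mult.commute)
        then show ?thesis using e\<rho> by (simp add: s_def)
      next
        case False
        moreover have "0 \<le> \<epsilon> * \<rho>" using \<epsilon> \<rho>0 by simp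
        ultimately show ?thesis using Pn unfolding s_def by linarith
      qed
    next
      case False
      \<comment> \<open>The gap \<open>r - \<tau>\<close> is not known to be small when
        \<open>\<rho>\<close> is; the cut-off keeps the backward shift local.\<close>
      define s where "s = min (r - \<tau>) (K * \<rho>)"
      have s0: "0 \<le> s" and sK: "s \<le> K * \<rho>" using False K \<rho>0 by (auto simp: s_def)
      obtain z where z: "reaches F s z x" "norm (z - x + s *\<^sub>R v) \<le> C2 * s * (norm (x - \<alpha>) + s)"
        using bwd[of x s] s0 sK \<rho>K \<rho>d x\<rho> by auto
      have zq: "norm (z - x + s *\<^sub>R v) \<le> D * (\<rho> * \<rho>)"
        using z(2) quad[OF C2 C(3) s0 sK] by linarith
      have "min_time F z y \<le> ereal (s + \<tau>)"
        by (rule min_time_le[OF reaches_trans[OF F(3) z(1) \<tau>]])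
      also have "\<dots> \<le> ereal r" by (simp add: s_def)
      finally have zr: "min_time F z y \<le> ereal r" .
      have "norm (z - x) \<le> norm (z - x + s *\<^sub>R v) + norm (s *\<^sub>R v)"
        using norm_triangle_ineq4[of "z - x + s *\<^sub>R v" "s *\<^sub>R v"] by simp
      also have "\<dots> \<le> D * \<rho> + (K * \<rho>) * norm v"
        using zq D\<rho> s0 sK by (intro add_mono) (auto intro: mult_right_mono)
      also have "\<dots> \<le> (Q - 1) * \<rho>"
        using \<rho>0 C K by (simp add: Q_def algebra_simps)
      finally have 1: "P + \<zeta> \<bullet> (z - x) \<le> e / 2 * \<rho>" by (rule shift[OF zr])
      have "- (\<zeta> \<bullet> (z - x + s *\<^sub>R v)) \<le> norm \<zeta> * norm (z - x + s *\<^sub>R v)"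
        using norm_cauchy_schwarz[of "- \<zeta>" "z - x + s *\<^sub>R v"] by simp
      also have "\<dots> \<le> n * (D * (\<rho> * \<rho>))" using n zq by (intro mult_mono) auto
      also note small
      finally have "s \<le> \<zeta> \<bullet> (z - x) + e / 2 * \<rho>"
        using v(2) by (simp add: inner_add_right inner_commute)
      then have 2: "P + s \<le> e * \<rho>" using 1 by simp
      show ?thesis
      proof (cases "s = r - \<tau>")
        case True
        then show ?thesis using 2 e\<rho> by simp
      next
        case ne: False
        then have "s = K * \<rho>" by (auto simp: s_def min_def split: if_splits)
        then have "n * \<rho> + 2 * \<rho> = s" by (simp add: K_def algebra_simps)
        moreover have "e * \<rho> \<le> \<rho>" using e \<rho>0 by (simp add: mult_left_le_one_le)
        ultimately have "\<rho> = 0" using 2 Pn \<rho>0 by linarith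
        \<comment> \<open>At the base point itself no trajectory is faster than \<open>r\<close>,
          which contradicts \<open>\<tau> < r\<close>.\<close>
        then have "x = \<alpha>" "y = \<beta>" by (auto simp: \<rho>_def p zero_prod_def)
        then have "r \<le> \<tau>" using min_time_le[OF \<tau>] T by simp
        then show ?thesis using False by simp
      qed
    qed
    \<comment> \<open>The bound holds for every connecting time, hence for the infimum; without a
      connecting trajectory the infimum is infinite.\<close>
    show "ereal (r + (\<zeta>, \<theta>) \<bullet> (p - (\<alpha>, \<beta>)) - \<epsilon> * norm (p - (\<alpha>, \<beta>))) \<le> min_time F (fst p) (snd p)"
      unfolding \<rho>_def[symmetric] P_def[symmetric] min_time_eq
      by (rule Inf_greatest) (use main p in auto)
  qed
qed

theorem theorem3p3:
  fixes F :: "real ^ 'n::finite \<Rightarrow> (real ^ 'n) set"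
    and \<alpha> \<beta> :: "real ^ 'n" and r :: real
  assumes "compact_convex_valued F"
    and "locally_Lipschitz F"
    and "linear_growth F"
    and "min_time F \<alpha> \<beta> = ereal r"
    and "0 < r"
  shows "frechet_subdifferential (\<lambda>(x, y). min_time F x y) (\<alpha>, \<beta>) =
    frechet_normal_cone (reachable_pairs F r) (\<alpha>, \<beta>) \<inter>
      {(\<zeta>, \<theta>). hamiltonian F \<alpha> \<zeta> = -1 \<and> hamiltonian F \<beta> (- \<theta>) = -1}"
proof -
  note F = assms(1-3)
  let ?T = "\<lambda>(x, y). min_time F x y"
  have sub_iff: "q \<in> frechet_subdifferential ?T (\<alpha>, \<beta>) \<longleftrightarrow>
    (\<forall>\<epsilon>>0. \<exists>\<delta>>0. \<forall>p. norm (p - (\<alpha>, \<beta>)) < \<delta> \<longrightarrow>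
      ereal (r + q \<bullet> (p - (\<alpha>, \<beta>)) - \<epsilon> * norm (p - (\<alpha>, \<beta>))) \<le> min_time F (fst p) (snd p))" for q
  proof (subst frechet_subdifferential_iff[where r = r])
    show "?T p \<noteq> - \<infinity>" for p using min_time_nonneg[of F "fst p" "snd p"] by (cases p) auto
  qed (use assms(4) in \<open>auto simp: case_prod_unfold\<close>)
  show ?thesis
  proof (intro set_eqI iffI)
    fix q assume "q \<in> frechet_subdifferential ?T (\<alpha>, \<beta>)"
    then have q: "\<exists>\<delta>>0. \<forall>p. norm (p - (\<alpha>, \<beta>)) < \<delta> \<longrightarrow>
      ereal (r + q \<bullet> (p - (\<alpha>, \<beta>)) - \<epsilon> * norm (p - (\<alpha>, \<beta>))) \<le> min_time F (fst p) (snd p)"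
      if "\<epsilon> > 0" for \<epsilon> using that unfolding sub_iff by blast
    obtain \<zeta> \<theta> where q_eq: "q = (\<zeta>, \<theta>)" by (cases q)
    \<comment> \<open>On \<open>reachable_pairs F r\<close> the minimal time is at most
      \<open>r\<close>, so the values cancel from the subgradient inequality and the normal
      inequality remains.\<close>
    have "q \<in> frechet_normal_cone (reachable_pairs F r) (\<alpha>, \<beta>)"
      unfolding frechet_normal_cone_def
    proof (intro CollectI allI impI)
      fix \<epsilon> :: real assume "\<epsilon> > 0"
      then obtain \<delta> where \<delta>: "\<delta> > 0" "\<And>p. norm (p - (\<alpha>, \<beta>)) < \<delta> \<Longrightarrow>
          ereal (r + q \<bullet> (p - (\<alpha>, \<beta>)) - \<epsilon> * norm (p - (\<alpha>, \<beta>))) \<le> min_time F (fst p) (snd p)"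
        using q by blast
      show "\<exists>\<delta>>0. \<forall>p\<in>reachable_pairs F r. norm (p - (\<alpha>, \<beta>)) < \<delta> \<longrightarrow>
          q \<bullet> (p - (\<alpha>, \<beta>)) \<le> \<epsilon> * norm (p - (\<alpha>, \<beta>))"
      proof (intro exI[of _ \<delta>] conjI ballI impI \<delta>(1))
        fix p assume p: "p \<in> reachable_pairs F r" "norm (p - (\<alpha>, \<beta>)) < \<delta>"
        note \<delta>(2)[OF p(2)]
        also have "min_time F (fst p) (snd p) \<le> ereal r"
          using p(1) by (auto simp: reachable_pairs_def)
        finally have "ereal (r + q \<bullet> (p - (\<alpha>, \<beta>)) - \<epsilon> * norm (p - (\<alpha>, \<beta>))) \<le> ereal r" .
        then show "q \<bullet> (p - (\<alpha>, \<beta>)) \<le> \<epsilon> * norm (p - (\<alpha>, \<beta>))" by simp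
      qed
    qed
    moreover have "hamiltonian F \<alpha> \<zeta> = -1"
    proof -
      \<comment> \<open>Freezing the second argument at \<open>\<beta>\<close> makes
        \<open>\<zeta>\<close> a subgradient in the first.\<close>
      have "\<exists>\<delta>>0. \<forall>x. norm (x - \<alpha>) < \<delta> \<longrightarrow>
        ereal (r + \<zeta> \<bullet> (x - \<alpha>) - \<epsilon> * norm (x - \<alpha>)) \<le> min_time F x \<beta>" if pos: "\<epsilon> > 0" for \<epsilon>
      proof -
        obtain \<delta> where \<delta>: "\<delta> > 0" "\<And>p. norm (p - (\<alpha>, \<beta>)) < \<delta> \<Longrightarrow>
          ereal (r + q \<bullet> (p - (\<alpha>, \<beta>)) - \<epsilon> * norm (p - (\<alpha>, \<beta>))) \<le> min_time F (fst p) (snd p)"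
          using q[OF pos] by blast
        then show ?thesis
          using \<delta>(2)[of "(x, \<beta>)" for x] by (intro exI[of _ \<delta>]) (simp add: q_eq norm_Pair)
      qed
      from hamiltonian_subgradient_ge[OF F assms(4) this] hamiltonian_subgradient_le[OF F assms(4,5) this]
      show ?thesis by simp
    qed
    moreover have "hamiltonian F \<beta> (- \<theta>) = -1"
    proof -
      \<comment> \<open>For the reversed dynamics the minimal time from \<open>\<beta>\<close> to
        \<open>\<alpha>\<close> is the same and \<open>\<theta>\<close> belongs to the initial
        point; the Hamiltonian of \<open>-F\<close> at \<open>\<theta>\<close> is that of
        \<open>F\<close> at \<open>- \<theta>\<close>.\<close>
      let ?G = "\<lambda>x. uminus ` F x"
      have G: "compact_convex_valued ?G" "locally_Lipschitz ?G" "linear_growth ?G"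
        using F compact_convex_valued_uminus locally_Lipschitz_uminus linear_growth_uminus by auto
      have T: "min_time ?G \<beta> \<alpha> = ereal r" using assms(4) min_time_uminus[OF F(3)] by simp
      have "\<exists>\<delta>>0. \<forall>x. norm (x - \<beta>) < \<delta> \<longrightarrow>
        ereal (r + \<theta> \<bullet> (x - \<beta>) - \<epsilon> * norm (x - \<beta>)) \<le> min_time ?G x \<alpha>" if pos: "\<epsilon> > 0" for \<epsilon>
      proof -
        obtain \<delta> where \<delta>: "\<delta> > 0" "\<And>p. norm (p - (\<alpha>, \<beta>)) < \<delta> \<Longrightarrow>
          ereal (r + q \<bullet> (p - (\<alpha>, \<beta>)) - \<epsilon> * norm (p - (\<alpha>, \<beta>))) \<le> min_time F (fst p) (snd p)"
          using q[OF pos] by blast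
        then show ?thesis unfolding min_time_uminus[OF F(3)]
          using \<delta>(2)[of "(\<alpha>, x)" for x] by (intro exI[of _ \<delta>]) (simp add: q_eq norm_Pair)
      qed
      from hamiltonian_subgradient_ge[OF G T this] hamiltonian_subgradient_le[OF G T assms(5) this]
      show ?thesis by (simp add: hamiltonian_uminus)
    qed
    ultimately show "q \<in> frechet_normal_cone (reachable_pairs F r) (\<alpha>, \<beta>) \<inter>
      {(\<zeta>, \<theta>). hamiltonian F \<alpha> \<zeta> = -1 \<and> hamiltonian F \<beta> (- \<theta>) = -1}" by (simp add: q_eq)
  next
    fix q assume q: "q \<in> frechet_normal_cone (reachable_pairs F r) (\<alpha>, \<beta>) \<inter>
      {(\<zeta>, \<theta>). hamiltonian F \<alpha> \<zeta> = -1 \<and> hamiltonian F \<beta> (- \<theta>) = -1}"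
    obtain \<zeta> \<theta> where q_eq: "q = (\<zeta>, \<theta>)" by (cases q)
    show "q \<in> frechet_subdifferential ?T (\<alpha>, \<beta>)"
      unfolding sub_iff using q unfolding q_eq
      by (intro allI impI normal_imp_subgradient[OF F _ assms(4)]) auto
  qed
qed

end
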